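(* Let $\mathcal{A}$ be a unital $C^*$-algebra, let $\mathcal{F}\subseteq\mathcal{A}$ be an ideal of finite type elements, let $F\in\mathcal{M}\mathcal{K}\Phi(\mathcal{A})$ and $K\in\mathcal{F}$. Then $F+K\in\mathcal{M}\mathcal{K}\Phi(\mathcal{A})$ and $$\operatorname{index}(F+K)=\operatorname{index}F\quad\text{in }K(\mathcal{F}).$$
   Context: $\mathcal{A}$ is regarded as a right Hilbert $C^*$-module over itself with $\langle x,y\rangle=x^*y$. $B(\mathcal{A})$ is the $C^*$-algebra of bounded $\mathcal{A}$-linear operators on $\mathcal{A}$ (all are adjointable); it is identified with $\mathcal{A}$ via $a\mapsto L_a$ (left multiplication), so elements and ideals of $\mathcal{A}$ are also regarded as elements and ideals of $B(\mathcal{A})$. Ideal of finite type elements: a subalgebra $\mathcal{F}\subseteq\mathcal{A}$ (not assumed closed) such that (i) $\mathcal{F}$ is a selfadjoint two-sided ideal of $\mathcal{A}$; (ii) $\mathcal{F}$ has an approximate unit consisting of projections, i.e. an increasing net $(p_\alpha)$ of projections in $\mathcal{F}$ with $\|p_\alpha a-a\|\to0$ and $\|ap_\alpha-a\|\to0$ for all $a\in\mathcal{F}$; (iii) for all projections $p,q\in\mathcal{F}$ there is $v\in\mathcal{A}$ with $vv^*=q$ and $v^*v\perp p$ (i.e. $v^*v+p$ is a projection). $K(\mathcal{F})$: on the set $\mathrm{Proj}(\mathcal{F})$ of (orthogonal) projections in $\mathcal{F}$ put $p\sim q$ iff there is $v\in\mathcal{A}$ with $vv^*=p$, $v^*v=q$.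 The set $S(\mathcal{F})=\mathrm{Proj}(\mathcal{F})/\!\sim$ is a commutative semigroup under $[p]+[q]=[p'+q']$, where $p'\sim p$, $q'\sim q$ are mutually orthogonal projections in $\mathcal{F}$ (these exist by (iii)). $K(\mathcal{F})$ is the Grothendieck group of $S(\mathcal{F})$, and $[p]$ also denotes the class of $p$ in $K(\mathcal{F})$. Submodules: $M\tilde\oplus N=\mathcal{A}$ means $M,N$ are closed submodules with $M\cap N=\{0\}$, $M+N=\mathcal{A}$ (not necessarily orthogonal). A closed submodule $N$ of $\mathcal{A}$ is complementable if $M\tilde\oplus N=\mathcal{A}$ for some closed submodule $M$; every such $N$ is orthogonally complementable in $\mathcal{A}$, and $P_N\in B(\mathcal{A})$ denotes the orthogonal projection onto $N$. An isomorphism of Hilbert modules is a bounded $\mathcal{A}$-linear bijection. $\mathcal{M}\mathcal{K}\Phi(\mathcal{A})$: an $\mathcal{M}\mathcal{K}\Phi$-decomposition for $F\in B(\mathcal{A})$ is a pair of decompositions $\mathcal{A}=M_1\tilde\oplus N_1\stackrel{F}{\longrightarrow}M_2\tilde\oplus N_2=\mathcal{A}$ with respect to which $F$ has the matrix $\begin{pmatrix}F_1&0\\0&F_4\end{pmatrix}$ with $F_1$ an isomorphism (i.e. $F$ maps $M_1$ isomorphically onto $M_2$ and $F(N_1)\subseteq N_2$), and such that $P_{N_1},P_{N_2}\in\mathcal{F}$. $F\in\mathcal{M}\mathcal{K}\Phi(\mathcal{A})$ means such a decomposition exists, and then $\operatorname{index}F=[P_{N_1}]-[P_{N_2}]\in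 K(\mathcal{F})$, which does not depend on the choice of the $\mathcal{M}\mathcal{K}\Phi$-decomposition. *)

theory Defs
  imports "HOL-Analysis.Analysis" "HOL-Algebra.Group"
begin

section \<open>Unital C*-algebras\<close>

text \<open>The classes \<open>real_normed_algebra_1\<close> and \<open>banach\<close> only know real scalars. The complex
  scalar multiplication \<open>scaleC\<close> extends the real one. As usual for unital Banach algebras,
  \<open>norm 1 = 1\<close>.\<close>

class cstar_algebra = real_normed_algebra_1 + banach +
  fixes scaleC :: "complex \<Rightarrow> 'a \<Rightarrow> 'a" (infixr \<open>*\<^sub>C\<close> 75)
    and star :: "'a \<Rightarrow> 'a" (\<open>_\<^sup>\<star>\<close> [1000] 1000)
  assumes scaleC_of_real: "complex_of_real r *\<^sub>C x = r *\<^sub>R x"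
    and scaleC_add_right: "c *\<^sub>C (x + y) = c *\<^sub>C x + c *\<^sub>C y"
    and scaleC_add_left: "(c + d) *\<^sub>C x = c *\<^sub>C x + d *\<^sub>C x"
    and scaleC_scaleC: "c *\<^sub>C (d *\<^sub>C x) = (c * d) *\<^sub>C x"
    and mult_scaleC_left: "(c *\<^sub>C x) * y = c *\<^sub>C (x * y)"
    and mult_scaleC_right: "x * (c *\<^sub>C y) = c *\<^sub>C (x * y)"
    and norm_scaleC: "norm (c *\<^sub>C x) = cmod c * norm x"
    and star_star: "(x\<^sup>\<star>)\<^sup>\<star> = x"
    and star_add: "(x + y)\<^sup>\<star> = x\<^sup>\<star> + y\<^sup>\<star>"
    and star_scaleC: "(c *\<^sub>C x)\<^sup>\<star> = cnj c *\<^sub>C x\<^sup>\<star>"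
    and star_mult: "(x * y)\<^sup>\<star> = y\<^sup>\<star> * x\<^sup>\<star>"
    and cstar_identity: "norm (x\<^sup>\<star> * x) = (norm x)\<^sup>2"

definition is_proj :: "'a::cstar_algebra \<Rightarrow> bool" where
  "is_proj p \<longleftrightarrow> p * p = p \<and> p\<^sup>\<star> = p"

definition proj_orth :: "'a::cstar_algebra \<Rightarrow> 'a \<Rightarrow> bool" (infix \<open>\<bottom>\<^sub>p\<close> 50) where
  "p \<bottom>\<^sub>p q \<longleftrightarrow> p * q = 0"

definition proj_le :: "'a::cstar_algebra \<Rightarrow> 'a \<Rightarrow> bool" (infix \<open>\<le>\<^sub>p\<close> 50) where
  "p \<le>\<^sub>p q \<longleftrightarrow> p * q = p"

lemma star_zero: "(0::'a::cstar_algebra)\<^sup>\<star> = 0"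
  by (metis add_cancel_right_left star_add)

lemma star_minus: "(- x :: 'a::cstar_algebra)\<^sup>\<star> = - (x\<^sup>\<star>)"
  by (metis add.right_inverse add_eq_0_iff star_add star_zero)

lemma star_diff: "(x - y :: 'a::cstar_algebra)\<^sup>\<star> = x\<^sup>\<star> - y\<^sup>\<star>"
  using star_add[of x "- y"] by (simp add: star_minus)

lemma star_one: "(1::'a::cstar_algebra)\<^sup>\<star> = 1"
  by (metis mult.left_neutral mult.right_neutral star_mult star_star)

lemma proj_orth_iff:
  assumes "is_proj p" "is_proj q"
  shows "p \<bottom>\<^sub>p q \<longleftrightarrow> is_proj (p + q)"
proof
  assume "p \<bottom>\<^sub>p q"
  hence pq: "p * q = 0" by (simp add: proj_orth_def)
  have "q * p = (p * q)\<^sup>\<star>" using assms by (simp add: star_mult is_proj_def)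
  hence "q * p = 0" by (simp add: pq star_zero)
  with pq show "is_proj (p + q)" using assms by (simp add: is_proj_def star_add algebra_simps)
next
  assume "is_proj (p + q)"
  hence "(p + q) * (p + q) = p + q" by (simp add: is_proj_def)
  hence *: "p * q + q * p = 0" using assms by (simp add: is_proj_def algebra_simps)
  have "p * (p * q + q * p) = p * q + p * q * p" "(p * q + q * p) * p = p * q * p + q * p"
    using assms by (simp_all add: is_proj_def distrib_left distrib_right mult.assoc)
      (metis mult.assoc)
  hence "p * q = q * p" using * by (metis add.commute add_left_imp_eq mult_zero_left mult_zero_right)
  with * have "2 *\<^sub>R (p * q) = 0" by (simp add: scaleR_2)
  thus "p \<bottom>\<^sub>p q" by (simp add: proj_orth_def)
qed

lemma proj_orth_commute:
  assumes "is_proj p" "is_proj q" shows "p \<bottom>\<^sub>p q \<longleftrightarrow> q \<bottom>\<^sub>p p"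
  by (simp only: proj_orth_iff[OF assms] proj_orth_iff[OF assms(2,1)] add.commute)


section \<open>Ideals of finite type elements\<close>

definition net_filter :: "'i set \<Rightarrow> ('i \<Rightarrow> 'i \<Rightarrow> bool) \<Rightarrow> 'i filter" where
  "net_filter I rel = (INF i\<in>I. principal {j \<in> I. rel i j})"

definition directed_index :: "'i set \<Rightarrow> ('i \<Rightarrow> 'i \<Rightarrow> bool) \<Rightarrow> bool" where
  "directed_index I rel \<longleftrightarrow> I \<noteq> {} \<and> (\<forall>i\<in>I. rel i i) \<and>
     (\<forall>i\<in>I. \<forall>j\<in>I. \<forall>k\<in>I. rel i j \<longrightarrow> rel j k \<longrightarrow> rel i k) \<and>
     (\<forall>i\<in>I. \<forall>j\<in>I. \<exists>k\<in>I. rel i k \<and> rel j k)"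

lemma eventually_net_filter:
  assumes "directed_index I rel"
  shows "eventually P (net_filter I rel) \<longleftrightarrow> (\<exists>i\<in>I. \<forall>j\<in>I. rel i j \<longrightarrow> P j)"
proof -
  have "eventually P (net_filter I rel) \<longleftrightarrow> (\<exists>i\<in>I. eventually P (principal {j \<in> I. rel i j}))"
    unfolding net_filter_def
  proof (rule eventually_INF_base)
    show "I \<noteq> {}" using assms by (simp add: directed_index_def)
    fix a b assume ab: "a \<in> I" "b \<in> I"
    then obtain k where k: "k \<in> I" "rel a k" "rel b k"
      using assms unfolding directed_index_def by meson
    have "{j \<in> I. rel k j} \<subseteq> {j \<in> I. rel a j} \<inter> {j \<in> I. rel b j}"
      using assms ab k unfolding directed_index_def by blast
    with k show "\<exists>x\<in>I. principal {j \<in> I. rel x j}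
        \<le> inf (principal {j \<in> I. rel a j}) (principal {j \<in> I. rel b j})"
      by auto
  qed
  thus ?thesis by (auto simp: eventually_principal)
qed

definition proj_approx_unit ::
  "'a::cstar_algebra set \<Rightarrow> 'i set \<Rightarrow> ('i \<Rightarrow> 'i \<Rightarrow> bool) \<Rightarrow> ('i \<Rightarrow> 'a) \<Rightarrow> bool" where
  "proj_approx_unit \<F> I rel p \<longleftrightarrow> directed_index I rel \<and>
     (\<forall>i\<in>I. p i \<in> \<F> \<and> is_proj (p i)) \<and>
     (\<forall>i\<in>I. \<forall>j\<in>I. rel i j \<longrightarrow> p i \<le>\<^sub>p p j) \<and>
     (\<forall>a\<in>\<F>. ((\<lambda>i. norm (p i * a - a)) \<longlongrightarrow> 0) (net_filter I rel) \<and>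
            ((\<lambda>i. norm (a * p i - a)) \<longlongrightarrow> 0) (net_filter I rel))"

text \<open>The index set of the net in \<open>finite_type_ideal\<close> is taken inside the algebra itself. This is no
  restriction: an increasing net of projections can be re-indexed by its range.\<close>

lemma proj_approx_unit_reindex:
  fixes \<F> :: "'a::cstar_algebra set" and I :: "'i set"
  assumes "proj_approx_unit \<F> I rel p"
  shows "proj_approx_unit \<F> (p ` I) (\<le>\<^sub>p) (\<lambda>q. q)"
proof -
  have dir: "directed_index I rel" and pr: "\<And>i. i \<in> I \<Longrightarrow> p i \<in> \<F> \<and> is_proj (p i)"
    and mono: "\<And>i j. i \<in> I \<Longrightarrow> j \<in> I \<Longrightarrow> rel i j \<Longrightarrow> p i \<le>\<^sub>p p j"
    and lim: "\<And>a. a \<in> \<F> \<Longrightarrow> ((\<lambda>i. norm (p i * a - a)) \<longlongrightarrow> 0) (net_filter I rel)"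
       "\<And>a. a \<in> \<F> \<Longrightarrow> ((\<lambda>i. norm (a * p i - a)) \<longlongrightarrow> 0) (net_filter I rel)"
    using assms unfolding proj_approx_unit_def by auto
  have dir': "directed_index (p ` I) (\<le>\<^sub>p)"
    unfolding directed_index_def
  proof (intro conjI ballI impI)
    show "p ` I \<noteq> {}" using dir by (simp add: directed_index_def)
    show "x \<le>\<^sub>p x" if "x \<in> p ` I" for x using that pr by (auto simp: proj_le_def is_proj_def)
    show "x \<le>\<^sub>p z" if "x \<le>\<^sub>p y" "y \<le>\<^sub>p z" for x y z :: 'a
      using that unfolding proj_le_def by (metis mult.assoc)
    show "\<exists>z\<in>p ` I. x \<le>\<^sub>p z \<and> y \<le>\<^sub>p z" if "x \<in> p ` I" "y \<in> p ` I" for x y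
      using that dir mono unfolding directed_index_def by (metis (no_types, lifting) image_iff)
  qed
  have nrm: "norm (1 - q) \<le> 1" if "is_proj q" for q :: 'a
  proof -
    have "(norm (1 - q))\<^sup>2 = norm (1 - q)"
      using that cstar_identity[of "1 - q"] by (simp add: is_proj_def star_diff star_one algebra_simps)
    thus ?thesis by (metis mult_cancel_right1 norm_ge_zero order.refl power2_eq_square zero_le_one)
  qed
  have le1: "norm (q * a - a) \<le> norm (r * a - a)" and le2: "norm (a * q - a) \<le> norm (a * r - a)"
    if "is_proj q" "is_proj r" "r \<le>\<^sub>p q" for a q r :: 'a
  proof -
    have rq: "r * q = r" using that(3) by (simp add: proj_le_def)
    have qr: "q * r = r" using arg_cong[OF rq, of star] that by (simp add: star_mult is_proj_def)
    have "q * a - a = (1 - q) * (r * a - a)"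
      by (simp add: algebra_simps) (metis mult.assoc qr)
    thus "norm (q * a - a) \<le> norm (r * a - a)"
      using norm_mult_ineq[of "1 - q" "r * a - a"]
        mult_left_le_one_le[OF norm_ge_zero norm_ge_zero nrm[OF that(1)], of "r * a - a"] by simp
    have "a * q - a = (a * r - a) * (1 - q)"
      by (simp add: algebra_simps rq)
    thus "norm (a * q - a) \<le> norm (a * r - a)"
      using norm_mult_ineq[of "a * r - a" "1 - q"]
        mult_right_le_one_le[OF norm_ge_zero norm_ge_zero nrm[OF that(1)], of "a * r - a"] by simp
  qed
  have main: "((\<lambda>q. norm (f q)) \<longlongrightarrow> 0) (net_filter (p ` I) (\<le>\<^sub>p))"
    if lim0: "((\<lambda>i. norm (f (p i))) \<longlongrightarrow> 0) (net_filter I rel)"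
      and dec: "\<And>q r. is_proj q \<Longrightarrow> is_proj r \<Longrightarrow> r \<le>\<^sub>p q \<Longrightarrow> norm (f q) \<le> norm (f r)"
    for f :: "'a \<Rightarrow> 'a"
  proof (rule tendstoI)
    fix e :: real assume "0 < e"
    hence "\<forall>\<^sub>F i in net_filter I rel. norm (f (p i)) < e"
      using tendstoD[OF lim0] by simp
    then obtain i where i: "i \<in> I" "\<forall>j\<in>I. rel i j \<longrightarrow> norm (f (p j)) < e"
      unfolding eventually_net_filter[OF dir] by blast
    have "norm (f (p i)) < e" using i dir unfolding directed_index_def by blast
    hence "norm (f (p j)) < e" if "j \<in> I" "p i \<le>\<^sub>p p j" for j
      using dec[of "p j" "p i"] that i(1) pr by fastforce
    thus "\<forall>\<^sub>F q in net_filter (p ` I) (\<le>\<^sub>p). dist (norm (f q)) 0 < e"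
      unfolding eventually_net_filter[OF dir'] using i(1) by auto
  qed
  show ?thesis
    unfolding proj_approx_unit_def
  proof (intro conjI ballI impI)
    fix a assume "a \<in> \<F>"
    show "((\<lambda>q. norm (q * a - a)) \<longlongrightarrow> 0) (net_filter (p ` I) (\<le>\<^sub>p))"
      by (rule main[OF lim(1)[OF \<open>a \<in> \<F>\<close>] le1])
    show "((\<lambda>q. norm (a * q - a)) \<longlongrightarrow> 0) (net_filter (p ` I) (\<le>\<^sub>p))"
      by (rule main[OF lim(2)[OF \<open>a \<in> \<F>\<close>] le2])
  next
    show "directed_index (p ` I) (\<le>\<^sub>p)" by (rule dir')
  next
    fix q assume "q \<in> p ` I"
    thus "q \<in> \<F>" "is_proj q" using pr by blast+
  next
    fix q r :: 'a assume "q \<le>\<^sub>p r"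
    thus "q \<le>\<^sub>p r" .
  qed
qed

definition finite_type_ideal :: "'a::cstar_algebra set \<Rightarrow> bool" where
  "finite_type_ideal \<F> \<longleftrightarrow>
     0 \<in> \<F> \<and> (\<forall>x\<in>\<F>. \<forall>y\<in>\<F>. x + y \<in> \<F> \<and> x * y \<in> \<F>) \<and> (\<forall>c. \<forall>x\<in>\<F>. c *\<^sub>C x \<in> \<F>) \<and>
     (\<forall>x\<in>\<F>. x\<^sup>\<star> \<in> \<F>) \<and> (\<forall>a. \<forall>x\<in>\<F>. a * x \<in> \<F> \<and> x * a \<in> \<F>) \<and>
     (\<exists>(I::'a set) rel p. proj_approx_unit \<F> I rel p) \<and>
     (\<forall>p\<in>\<F>. \<forall>q\<in>\<F>. is_proj p \<longrightarrow> is_proj q \<longrightarrow>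
        (\<exists>v. v * v\<^sup>\<star> = q \<and> (v\<^sup>\<star> * v) \<bottom>\<^sub>p p))"


section \<open>The group \<open>K(\<F>)\<close>\<close>

definition groth_rel :: "'s set \<Rightarrow> ('s \<Rightarrow> 's \<Rightarrow> 's) \<Rightarrow> (('s \<times> 's) \<times> ('s \<times> 's)) set" where
  "groth_rel S add = {((a, b), (c, d)). a \<in> S \<and> b \<in> S \<and> c \<in> S \<and> d \<in> S \<and>
     (\<exists>e\<in>S. add (add a d) e = add (add c b) e)}"

text \<open>The Grothendieck group of a commutative semigroup \<open>(S, add)\<close>, written multiplicatively because
  of the record type: \<open>mult\<close> is the addition and \<open>m_inv\<close> the negation. The class of \<open>(a, b)\<close> is the
  formal difference of \<open>a\<close> and \<open>b\<close>.\<close>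

definition groth_group :: "'s set \<Rightarrow> ('s \<Rightarrow> 's \<Rightarrow> 's) \<Rightarrow> ('s \<times> 's) set monoid" where
  "groth_group S add = \<lparr>
     carrier = (S \<times> S) // groth_rel S add,
     mult = (\<lambda>X Y. \<Union>(a, b)\<in>X. \<Union>(c, d)\<in>Y. groth_rel S add `` {(add a c, add b d)}),
     one = (\<Union>s\<in>S. groth_rel S add `` {(s, s)})\<rparr>"

text \<open>The canonical map from \<open>S\<close>; no neutral element of \<open>S\<close> is needed.\<close>

definition groth_class :: "'s set \<Rightarrow> ('s \<Rightarrow> 's \<Rightarrow> 's) \<Rightarrow> 's \<Rightarrow> ('s \<times> 's) set" where
  "groth_class S add s = groth_rel S add `` {(add s s, s)}"

lemma groth:
  fixes S :: "'s set" and add :: "'s \<Rightarrow> 's \<Rightarrow> 's"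
  assumes ne: "S \<noteq> {}"
    and cl: "\<And>a b. a \<in> S \<Longrightarrow> b \<in> S \<Longrightarrow> add a b \<in> S"
    and as: "\<And>a b c. a \<in> S \<Longrightarrow> b \<in> S \<Longrightarrow> c \<in> S \<Longrightarrow> add (add a b) c = add a (add b c)"
    and cm: "\<And>a b. a \<in> S \<Longrightarrow> b \<in> S \<Longrightarrow> add a b = add b a"
  shows groth_comm_group: "comm_group (groth_group S add)"
    and groth_diff: "\<And>s t. s \<in> S \<Longrightarrow> t \<in> S \<Longrightarrow>
      groth_class S add s \<otimes>\<^bsub>groth_group S add\<^esub> inv\<^bsub>groth_group S add\<^esub> (groth_class S add t)
      = groth_rel S add `` {(s, t)}"
proof -
  let ?R = "groth_rel S add"
  let ?G = "groth_group S add"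
  let ?c = "\<lambda>a b. ?R `` {(a, b)}"
  have lc: "add a (add b c) = add b (add a c)" if "a \<in> S" "b \<in> S" "c \<in> S" for a b c
    by (metis as cm that)
  note ac = as cm lc cl
  have R: "((a,b),(c,d)) \<in> ?R \<longleftrightarrow> a \<in> S \<and> b \<in> S \<and> c \<in> S \<and> d \<in> S \<and> (\<exists>e\<in>S. add (add a d) e = add (add c b) e)"
    for a b c d by (auto simp: groth_rel_def)
  have eqv: "equiv (S \<times> S) ?R"
  proof (rule equivI)
    show "?R \<subseteq> (S \<times> S) \<times> (S \<times> S)" by (auto simp: groth_rel_def)
    show "refl_on (S \<times> S) ?R" by (rule refl_onI) (use ne in \<open>auto simp: R\<close>)
    show "sym ?R" by (rule symI) (auto simp: R, metis)
    show "trans ?R"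
    proof (rule transI)
      fix x y z assume "(x, y) \<in> ?R" "(y, z) \<in> ?R"
      then obtain a b c d e f g h where xyz: "x = (a, b)" "y = (c, d)" "z = (e, f)"
        and S: "a \<in> S" "b \<in> S" "c \<in> S" "d \<in> S" "e \<in> S" "f \<in> S" "g \<in> S" "h \<in> S"
        and 1: "add (add a d) g = add (add c b) g" and 2: "add (add c f) h = add (add e d) h"
        by (cases x; cases y; cases z) (auto simp: R)
      let ?k = "add c (add d (add g h))"
      have "add (add a f) ?k = add (add (add a d) g) (add (add c f) h)" using S by (simp add: ac)
      also have "\<dots> = add (add (add c b) g) (add (add e d) h)" by (simp add: 1 2)
      also have "\<dots> = add (add e b) ?k" using S by (simp add: ac)
      finally show "(x, z) \<in> ?R" using S cl by (auto simp: xyz R)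
    qed
  qed
  have ceq: "?c a b = ?c c d \<longleftrightarrow> ((a,b),(c,d)) \<in> ?R" if "a \<in> S" "b \<in> S" "c \<in> S" "d \<in> S" for a b c d
    using eq_equiv_class_iff[OF eqv] that by simp
  have car: "X \<in> carrier ?G \<longleftrightarrow> (\<exists>a\<in>S. \<exists>b\<in>S. X = ?c a b)" for X
    by (auto simp: groth_group_def quotient_def)
  have mul: "?c a b \<otimes>\<^bsub>?G\<^esub> ?c c d = ?c (add a c) (add b d)"
    if S: "a \<in> S" "b \<in> S" "c \<in> S" "d \<in> S" for a b c d
  proof -
    have *: "?c (add a' c') (add b' d') = ?c (add a c) (add b d)"
      if "((a,b),(a',b')) \<in> ?R" "((c,d),(c',d')) \<in> ?R" for a' b' c' d'
    proof -
      from that obtain e f where S': "a' \<in> S" "b' \<in> S" "c' \<in> S" "d' \<in> S" "e \<in> S" "f \<in> S"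
        and 1: "add (add a b') e = add (add a' b) e" and 2: "add (add c d') f = add (add c' d) f"
        by (auto simp: R)
      have "add (add (add a' c') (add b d)) (add e f) = add (add (add a' b) e) (add (add c' d) f)"
        using S S' by (simp add: ac)
      also have "\<dots> = add (add (add a b') e) (add (add c d') f)" by (simp add: 1 2)
      also have "\<dots> = add (add (add a c) (add b' d')) (add e f)" using S S' by (simp add: ac)
      finally show ?thesis using S S' cl by (subst ceq) (auto simp: R)
    qed
    have "(a,b) \<in> ?c a b" "(c,d) \<in> ?c c d" using S ne by (auto simp: R)
    hence ne': "?c a b \<noteq> {}" "?c c d \<noteq> {}" by blast+
    have "(\<Union>(a', b')\<in>?c a b. \<Union>(c', d')\<in>?c c d. ?c (add a' c') (add b' d'))
        = (\<Union>x\<in>?c a b. \<Union>y\<in>?c c d. ?c (add a c) (add b d))"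
    proof (rule SUP_cong[OF refl], clarify, rule SUP_cong[OF refl], clarify)
      fix a' b' c' d' assume "((a,b),(a',b')) \<in> ?R" "((c,d),(c',d')) \<in> ?R"
      thus "?c (add a' c') (add b' d') = ?c (add a c) (add b d)" by (rule *)
    qed
    also have "\<dots> = ?c (add a c) (add b d)" using ne' by simp
    finally show ?thesis by (simp add: groth_group_def)
  qed
  have one: "\<one>\<^bsub>?G\<^esub> = ?c s s" if "s \<in> S" for s
  proof -
    have "?c t t = ?c s s" if "t \<in> S" for t
      using that \<open>s \<in> S\<close> ne by (subst ceq) (auto simp: R cm[of t s])
    hence "(\<Union>t\<in>S. ?c t t) = (\<Union>t\<in>S. ?c s s)" by (rule SUP_cong[OF refl])
    also have "\<dots> = ?c s s" using ne by simp
    finally show ?thesis by (simp add: groth_group_def)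
  qed
  obtain s0 where s0: "s0 \<in> S" using ne by blast
  show G: "comm_group ?G"
  proof (rule comm_groupI)
    show "\<one>\<^bsub>?G\<^esub> \<in> carrier ?G" using s0 car one[OF s0] by blast
    fix x y assume "x \<in> carrier ?G" "y \<in> carrier ?G"
    then obtain a b c d where xy: "x = ?c a b" "y = ?c c d" and S: "a \<in> S" "b \<in> S" "c \<in> S" "d \<in> S"
      by (auto simp: car)
    show "x \<otimes>\<^bsub>?G\<^esub> y \<in> carrier ?G" unfolding xy mul[OF S] car using S cl by blast
    show "x \<otimes>\<^bsub>?G\<^esub> y = y \<otimes>\<^bsub>?G\<^esub> x" using S unfolding xy mul[OF S] mul[OF S(3,4,1,2)] by (simp add: cm)
    show "\<one>\<^bsub>?G\<^esub> \<otimes>\<^bsub>?G\<^esub> x = x"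
    proof -
      have "?c (add s0 a) (add s0 b) = ?c a b"
        using S s0 cl by (subst ceq) (auto simp: R ac)
      thus ?thesis using S s0 by (simp add: xy one[OF s0] mul)
    qed
    have "?c b a \<otimes>\<^bsub>?G\<^esub> x = \<one>\<^bsub>?G\<^esub>" 
      unfolding xy mul[OF S(2,1,1,2)] one[OF cl[OF S(1,2)]] by (simp add: cm S)
    thus "\<exists>y\<in>carrier ?G. y \<otimes>\<^bsub>?G\<^esub> x = \<one>\<^bsub>?G\<^esub>" using S car by blast
    fix z assume "z \<in> carrier ?G"
    then obtain e f where z: "z = ?c e f" "e \<in> S" "f \<in> S" by (auto simp: car)
    show "x \<otimes>\<^bsub>?G\<^esub> y \<otimes>\<^bsub>?G\<^esub> z = x \<otimes>\<^bsub>?G\<^esub> (y \<otimes>\<^bsub>?G\<^esub> z)"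
      using S z by (simp add: xy mul as cl)
  qed
  then interpret comm_group ?G .
  fix s t assume st: "s \<in> S" "t \<in> S"
  have "?c t (add t t) \<otimes>\<^bsub>?G\<^esub> groth_class S add t = \<one>\<^bsub>?G\<^esub>"
    using st cl by (simp add: groth_class_def mul cm one[of "add t (add t t)"])
  hence "inv\<^bsub>?G\<^esub> (groth_class S add t) = ?c t (add t t)"
    by (rule inv_equality) (use st cl car in \<open>unfold groth_class_def, blast+\<close>)
  hence "groth_class S add s \<otimes>\<^bsub>?G\<^esub> inv\<^bsub>?G\<^esub> (groth_class S add t) = ?c (add (add s s) t) (add s (add t t))"
    using st cl by (simp add: groth_class_def mul)
  also have "\<dots> = ?c s t" using st cl by (subst ceq) (auto simp: R ac)
  finally show "groth_class S add s \<otimes>\<^bsub>?G\<^esub> inv\<^bsub>?G\<^esub> (groth_class S add t) = ?c s t" .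
qed


definition Projs :: "'a::cstar_algebra set \<Rightarrow> 'a set" where
  "Projs \<F> = {p \<in> \<F>. is_proj p}"

definition mvn_rel :: "'a::cstar_algebra set \<Rightarrow> ('a \<times> 'a) set" where
  "mvn_rel \<F> = {(p, q). p \<in> Projs \<F> \<and> q \<in> Projs \<F> \<and> (\<exists>v. v * v\<^sup>\<star> = p \<and> v\<^sup>\<star> * v = q)}"

definition S_carrier :: "'a::cstar_algebra set \<Rightarrow> 'a set set" where
  "S_carrier \<F> = Projs \<F> // mvn_rel \<F>"

definition S_add :: "'a::cstar_algebra set \<Rightarrow> 'a set \<Rightarrow> 'a set \<Rightarrow> 'a set" where
  "S_add \<F> X Y = (\<Union>p\<in>X. \<Union>q\<in>{q\<in>Y. p \<bottom>\<^sub>p q}. mvn_rel \<F> `` {p + q})"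

definition K_group :: "'a::cstar_algebra set \<Rightarrow> ('a set \<times> 'a set) set monoid" where
  "K_group \<F> = groth_group (S_carrier \<F>) (S_add \<F>)"

definition K_class :: "'a::cstar_algebra set \<Rightarrow> 'a \<Rightarrow> ('a set \<times> 'a set) set" where
  "K_class \<F> p = groth_class (S_carrier \<F>) (S_add \<F>) (mvn_rel \<F> `` {p})"

text \<open>For an ideal of finite type elements, \<open>(S_carrier \<F>, S_add \<F>)\<close> is a commutative semigroup, so
  \<open>K_group \<F>\<close> is an abelian group.\<close>

lemma proj_diff_zero:
  fixes v :: "'a::cstar_algebra" assumes "is_proj (v\<^sup>\<star> * v)" shows "v * (v\<^sup>\<star> * v) = v"
proof -
  let ?q = "v\<^sup>\<star> * v"
  have q: "?q * ?q = ?q" "?q\<^sup>\<star> = ?q" using assms by (auto simp: is_proj_def)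
  have "(v * ?q - v)\<^sup>\<star> * (v * ?q - v) = ?q * ?q * ?q - ?q * ?q - ?q * ?q + ?q"
    by (simp add: star_diff star_mult star_star algebra_simps)
  also have "\<dots> = 0" by (simp add: q)
  finally show ?thesis using cstar_identity[of "v * ?q - v"] by simp
qed

lemma mvn_proj:
  fixes v :: "'a::cstar_algebra" assumes "is_proj (v * v\<^sup>\<star>)" shows "is_proj (v\<^sup>\<star> * v)"
proof -
  have "v\<^sup>\<star> * (v * v\<^sup>\<star>) = v\<^sup>\<star>" using proj_diff_zero[of "v\<^sup>\<star>"] assms by (simp add: star_star)
  hence "v\<^sup>\<star> * v * (v\<^sup>\<star> * v) = v\<^sup>\<star> * v" by (metis mult.assoc)
  thus ?thesis by (simp add: is_proj_def star_mult star_star)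
qed

context
  fixes \<F> :: "'a::cstar_algebra set"
  assumes ft: "finite_type_ideal \<F>"
begin

lemma F_ideal: "x \<in> \<F> \<Longrightarrow> a * x \<in> \<F>" "x \<in> \<F> \<Longrightarrow> x * a \<in> \<F>" "x \<in> \<F> \<Longrightarrow> y \<in> \<F> \<Longrightarrow> x + y \<in> \<F>" "0 \<in> \<F>"
  using ft unfolding finite_type_ideal_def by blast+

lemma mvn_equiv: "equiv (Projs \<F>) (mvn_rel \<F>)"
proof (rule equivI)
  show "mvn_rel \<F> \<subseteq> Projs \<F> \<times> Projs \<F>" by (auto simp: mvn_rel_def)
  show "refl_on (Projs \<F>) (mvn_rel \<F>)"
  proof (rule refl_onI)
    fix p assume "p \<in> Projs \<F>"
    moreover from this have "p * p\<^sup>\<star> = p" "p\<^sup>\<star> * p = p" by (simp_all add: Projs_def is_proj_def)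
    ultimately show "(p, p) \<in> mvn_rel \<F>" unfolding mvn_rel_def by blast
  qed
  show "sym (mvn_rel \<F>)"
    by (rule symI) (auto simp: mvn_rel_def, metis star_star)
  show "trans (mvn_rel \<F>)"
  proof (rule transI)
    fix p q r assume "(p, q) \<in> mvn_rel \<F>" "(q, r) \<in> mvn_rel \<F>"
    then obtain v w where P: "p \<in> Projs \<F>" "q \<in> Projs \<F>" "r \<in> Projs \<F>"
      and v: "v * v\<^sup>\<star> = p" "v\<^sup>\<star> * v = q" and w: "w * w\<^sup>\<star> = q" "w\<^sup>\<star> * w = r"
      by (auto simp: mvn_rel_def)
    have vq: "v * q = v" using proj_diff_zero[of v] v P by (auto simp: Projs_def)
    have wq: "w\<^sup>\<star> * q = w\<^sup>\<star>" using proj_diff_zero[of "w\<^sup>\<star>"] w P by (auto simp: Projs_def star_star)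
    have "v * w * (v * w)\<^sup>\<star> = v * q * v\<^sup>\<star>" by (simp add: star_mult mult.assoc flip: w)
    moreover have "(v * w)\<^sup>\<star> * (v * w) = w\<^sup>\<star> * q * w" by (simp add: star_mult mult.assoc flip: v)
    ultimately have "v * w * (v * w)\<^sup>\<star> = p" "(v * w)\<^sup>\<star> * (v * w) = r" by (simp_all add: vq wq v w)
    with P show "(p, r) \<in> mvn_rel \<F>" by (auto simp: mvn_rel_def)
  qed
qed

lemma mvn_sum:
  assumes "(p, p') \<in> mvn_rel \<F>" "(q, q') \<in> mvn_rel \<F>" "p \<bottom>\<^sub>p q" "p' \<bottom>\<^sub>p q'"
  shows "(p + q, p' + q') \<in> mvn_rel \<F>"
proof -
  obtain v w where P: "p \<in> Projs \<F>" "q \<in> Projs \<F>" "p' \<in> Projs \<F>" "q' \<in> Projs \<F>"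
      and v: "v * v\<^sup>\<star> = p" "v\<^sup>\<star> * v = p'" and w: "w * w\<^sup>\<star> = q" "w\<^sup>\<star> * w = q'"
    using assms by (auto simp: mvn_rel_def)
  have pr: "is_proj p" "is_proj q" "is_proj p'" "is_proj q'" using P by (auto simp: Projs_def)
  have z: "x * y\<^sup>\<star> = 0" if "is_proj (x\<^sup>\<star> * x)" "is_proj (y\<^sup>\<star> * y)" "(x\<^sup>\<star> * x) * (y\<^sup>\<star> * y) = 0" for x y :: 'a
  proof -
    have "y\<^sup>\<star> = (y\<^sup>\<star> * y) * y\<^sup>\<star>"
      using arg_cong[OF proj_diff_zero[OF that(2)], of star] by (simp add: star_mult star_star)
    hence "x * y\<^sup>\<star> = x * ((x\<^sup>\<star> * x) * (y\<^sup>\<star> * y)) * y\<^sup>\<star>"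
      using proj_diff_zero[OF that(1)] by (metis mult.assoc)
    thus ?thesis using that(3) by simp
  qed
  have o: "p * q = 0" "p' * q' = 0" using assms(3,4) by (auto simp: proj_orth_def)
  have "q * p = 0" "q' * p' = 0" using o pr star_mult[of p q] star_mult[of p' q']
    by (auto simp: is_proj_def star_zero)
  note o = o this
  have z1: "v * w\<^sup>\<star> = 0" "w * v\<^sup>\<star> = 0" by (rule z; simp add: v w pr o)+
  have z2: "v\<^sup>\<star> * w = 0" "w\<^sup>\<star> * v = 0"
    using z[of "v\<^sup>\<star>" "w\<^sup>\<star>"] z[of "w\<^sup>\<star>" "v\<^sup>\<star>"] by (simp_all add: v w pr o star_star)
  have "(v + w) * (v + w)\<^sup>\<star> = p + q" "(v + w)\<^sup>\<star> * (v + w) = p' + q'"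
    by (simp_all add: star_add algebra_simps v w z1 z2)
  moreover have "is_proj (p + q)" "is_proj (p' + q')" using proj_orth_iff pr assms by blast+
  ultimately show ?thesis using P F_ideal by (auto simp: mvn_rel_def Projs_def)
qed

lemma orth_rep:
  assumes "p \<in> Projs \<F>" "q \<in> Projs \<F>"
  obtains q' where "(q, q') \<in> mvn_rel \<F>" "p \<bottom>\<^sub>p q'"
proof -
  obtain v where v: "v * v\<^sup>\<star> = q" "(v\<^sup>\<star> * v) \<bottom>\<^sub>p p"
    using assms ft unfolding finite_type_ideal_def Projs_def by blast
  have pr: "is_proj (v\<^sup>\<star> * v)" using mvn_proj[of v] v assms by (auto simp: Projs_def)
  have "v\<^sup>\<star> * q * v = v\<^sup>\<star> * v * (v\<^sup>\<star> * v)" by (simp add: mult.assoc flip: v(1))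
  also have "\<dots> = v\<^sup>\<star> * v" using pr by (simp add: is_proj_def)
  finally have "v\<^sup>\<star> * v \<in> \<F>" using F_ideal assms by (metis (no_types, lifting) Projs_def mem_Collect_eq)
  moreover have "p \<bottom>\<^sub>p (v\<^sup>\<star> * v)"
    using v(2) pr assms by (simp add: proj_orth_commute Projs_def)
  ultimately show ?thesis using that[of "v\<^sup>\<star> * v"] v pr assms by (auto simp: mvn_rel_def Projs_def)
qed

lemma S_add_eq:
  assumes "(p, p') \<in> mvn_rel \<F>" "(q, q') \<in> mvn_rel \<F>" "p' \<bottom>\<^sub>p q'"
  shows "S_add \<F> (mvn_rel \<F> `` {p}) (mvn_rel \<F> `` {q}) = mvn_rel \<F> `` {p' + q'}"
proof -
  note e = mvn_equiv
  have tr: "(p', a) \<in> mvn_rel \<F>" if "(p, a) \<in> mvn_rel \<F>" for a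
    using e assms that unfolding equiv_def by (meson symD transD)
  have tr': "(q', a) \<in> mvn_rel \<F>" if "(q, a) \<in> mvn_rel \<F>" for a
    using e assms that unfolding equiv_def by (meson symD transD)
  have "mvn_rel \<F> `` {a + b} = mvn_rel \<F> `` {p' + q'}"
    if "(p, a) \<in> mvn_rel \<F>" "(q, b) \<in> mvn_rel \<F>" "a \<bottom>\<^sub>p b" for a b
    using equiv_class_eq[OF e mvn_sum[OF tr[OF that(1)] tr'[OF that(2)] assms(3) that(3)]] by simp
  thus ?thesis using assms unfolding S_add_def by blast
qed

lemma S_carrier_iff: "X \<in> S_carrier \<F> \<longleftrightarrow> (\<exists>p\<in>Projs \<F>. X = mvn_rel \<F> `` {p})"
  by (auto simp: S_carrier_def quotient_def)

lemma S_add_rep: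
  assumes "X \<in> S_carrier \<F>" "p \<in> Projs \<F>"
  obtains q where "q \<in> Projs \<F>" "X = mvn_rel \<F> `` {q}" "p \<bottom>\<^sub>p q"
proof -
  obtain q where q: "q \<in> Projs \<F>" "X = mvn_rel \<F> `` {q}" using assms S_carrier_iff by blast
  obtain q' where q': "(q, q') \<in> mvn_rel \<F>" "p \<bottom>\<^sub>p q'" using orth_rep assms(2) q(1) by blast
  have "X = mvn_rel \<F> `` {q'}" using equiv_class_eq[OF mvn_equiv q'(1)] q by simp
  moreover have "q' \<in> Projs \<F>" using q'(1) by (auto simp: mvn_rel_def)
  ultimately show ?thesis using that q' by blast
qed

lemma mvn_refl: "p \<in> Projs \<F> \<Longrightarrow> (p, p) \<in> mvn_rel \<F>"
  using mvn_equiv by (auto simp: equiv_def dest: refl_onD)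

lemma Projs_add:
  assumes "p \<in> Projs \<F>" "q \<in> Projs \<F>" "p \<bottom>\<^sub>p q" shows "p + q \<in> Projs \<F>"
  using assms F_ideal proj_orth_iff[of p q] by (auto simp: Projs_def)

lemma S_add_class:
  assumes "p \<in> Projs \<F>" "q \<in> Projs \<F>" "p \<bottom>\<^sub>p q"
  shows "S_add \<F> (mvn_rel \<F> `` {p}) (mvn_rel \<F> `` {q}) = mvn_rel \<F> `` {p + q}"
  using S_add_eq mvn_refl assms by blast

lemma
  shows S_nonempty: "S_carrier \<F> \<noteq> {}"
    and S_closed: "X \<in> S_carrier \<F> \<Longrightarrow> Y \<in> S_carrier \<F> \<Longrightarrow> S_add \<F> X Y \<in> S_carrier \<F>"
    and S_comm: "X \<in> S_carrier \<F> \<Longrightarrow> Y \<in> S_carrier \<F> \<Longrightarrow> S_add \<F> X Y = S_add \<F> Y X"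
    and S_assoc: "X \<in> S_carrier \<F> \<Longrightarrow> Y \<in> S_carrier \<F> \<Longrightarrow> Z \<in> S_carrier \<F> \<Longrightarrow>
      S_add \<F> (S_add \<F> X Y) Z = S_add \<F> X (S_add \<F> Y Z)"
proof -
  have "0 \<in> Projs \<F>" using F_ideal by (simp add: Projs_def is_proj_def star_zero)
  thus "S_carrier \<F> \<noteq> {}" using S_carrier_iff by blast
next
  assume X: "X \<in> S_carrier \<F>" and Y: "Y \<in> S_carrier \<F>"
  obtain p where p: "p \<in> Projs \<F>" "X = mvn_rel \<F> `` {p}" using X S_carrier_iff by blast
  obtain q where q: "q \<in> Projs \<F>" "Y = mvn_rel \<F> `` {q}" "p \<bottom>\<^sub>p q" using S_add_rep[OF Y p(1)] .
  have pq: "p + q \<in> Projs \<F>" using Projs_add p q by blast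
  have XY: "S_add \<F> X Y = mvn_rel \<F> `` {p + q}" using S_add_class p q by simp
  show "S_add \<F> X Y \<in> S_carrier \<F>" using XY pq S_carrier_iff by blast
  have "q \<bottom>\<^sub>p p" using p q by (simp add: proj_orth_commute Projs_def)
  thus "S_add \<F> X Y = S_add \<F> Y X" using S_add_class p q XY by (simp add: add.commute)
  assume Z: "Z \<in> S_carrier \<F>"
  obtain r where r: "r \<in> Projs \<F>" "Z = mvn_rel \<F> `` {r}" "(p + q) \<bottom>\<^sub>p r" using S_add_rep[OF Z pq] .
  have pqr: "(p + q) * r = 0" using r(3) by (simp add: proj_orth_def)
  have pq0: "p * q = 0" "p * p = p" using p q by (auto simp: proj_orth_def Projs_def is_proj_def)
  have "p * ((p + q) * r) = p * r" by (simp add: distrib_left pq0 flip: mult.assoc)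
  hence pr: "p * r = 0" using pqr by simp
  hence qr: "q * r = 0" using pqr by (simp add: distrib_right)
  have qr': "q + r \<in> Projs \<F>" using Projs_add q r qr by (simp add: proj_orth_def)
  have "S_add \<F> Y Z = mvn_rel \<F> `` {q + r}" using S_add_class q r qr by (simp add: proj_orth_def)
  moreover have "S_add \<F> X (mvn_rel \<F> `` {q + r}) = mvn_rel \<F> `` {p + (q + r)}"
    using S_add_class p qr' pr pq0 by (simp add: proj_orth_def distrib_left)
  moreover have "S_add \<F> (S_add \<F> X Y) Z = mvn_rel \<F> `` {p + q + r}"
    using S_add_class pq r XY by simp
  ultimately show "S_add \<F> (S_add \<F> X Y) Z = S_add \<F> X (S_add \<F> Y Z)" by (simp add: add.assoc)
qed

lemma K_comm_group: "comm_group (K_group \<F>)"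
  unfolding K_group_def using groth_comm_group[OF S_nonempty S_closed S_assoc S_comm] by blast

lemma K_diff:
  assumes "p \<in> Projs \<F>" "q \<in> Projs \<F>"
  shows "K_class \<F> p \<otimes>\<^bsub>K_group \<F>\<^esub> inv\<^bsub>K_group \<F>\<^esub> (K_class \<F> q)
    = groth_rel (S_carrier \<F>) (S_add \<F>) `` {(mvn_rel \<F> `` {p}, mvn_rel \<F> `` {q})}"
  unfolding K_group_def K_class_def
  using groth_diff[OF S_nonempty S_closed S_assoc S_comm] assms S_carrier_iff by blast

end


section \<open>The algebra as a right Hilbert module over itself\<close>

definition hinner :: "'a::cstar_algebra \<Rightarrow> 'a \<Rightarrow> 'a" where
  "hinner x y = x\<^sup>\<star> * y"

text \<open>\<open>B(\<A>)\<close>. Complex linearity is included: \<open>c *\<^sub>C x = x * (c *\<^sub>C 1)\<close>.\<close>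

definition module_ops :: "('a::cstar_algebra \<Rightarrow> 'a) set" where
  "module_ops = {T. bounded_linear T \<and> (\<forall>x a. T (x * a) = T x * a)}"

definition left_mult :: "'a::cstar_algebra \<Rightarrow> 'a \<Rightarrow> 'a" where
  "left_mult a = (\<lambda>x. a * x)"

lemma bij_betw_left_mult:
  "bij_betw left_mult UNIV (module_ops :: ('a::cstar_algebra \<Rightarrow> 'a) set)"
  unfolding bij_betw_def
proof
  show "inj (left_mult :: 'a \<Rightarrow> _)"
  proof (rule injI)
    fix a b :: 'a assume "left_mult a = left_mult b"
    from fun_cong[OF this, of 1] show "a = b" by (simp add: left_mult_def)
  qed
  have "T = left_mult (T 1)" if "T \<in> module_ops" for T :: "'a \<Rightarrow> 'a"
  proof
    fix x
    have "T (1 * x) = T 1 * x" using that unfolding module_ops_def by blast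
    thus "T x = left_mult (T 1) x" by (simp add: left_mult_def)
  qed
  moreover have "left_mult a \<in> module_ops" for a :: 'a
    by (simp add: module_ops_def left_mult_def bounded_linear_mult_right mult.assoc)
  ultimately show "range left_mult = (module_ops :: ('a \<Rightarrow> 'a) set)" by blast
qed

text \<open>As for \<open>module_ops\<close>, closure under complex scalars follows from closure under the right
  action.\<close>

definition closed_submodule :: "'a::cstar_algebra set \<Rightarrow> bool" where
  "closed_submodule M \<longleftrightarrow> closed M \<and> 0 \<in> M \<and> (\<forall>x\<in>M. \<forall>y\<in>M. x + y \<in> M) \<and>
     (\<forall>x\<in>M. \<forall>a. x * a \<in> M)"

definition direct_decomp :: "'a::cstar_algebra set \<Rightarrow> 'a set \<Rightarrow> bool" where
  "direct_decomp M N \<longleftrightarrow> closed_submodule M \<and> closed_submodule N \<and> M \<inter> N = {0} \<and>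
     {x + y | x y. x \<in> M \<and> y \<in> N} = UNIV"

definition is_orth_proj_onto :: "'a::cstar_algebra set \<Rightarrow> ('a \<Rightarrow> 'a) \<Rightarrow> bool" where
  "is_orth_proj_onto N P \<longleftrightarrow> P \<in> module_ops \<and>
     (\<forall>x. P x \<in> N \<and> (\<forall>n\<in>N. hinner n (x - P x) = 0))"

lemma is_orth_proj_onto_unique:
  assumes N: "closed_submodule N" and P: "is_orth_proj_onto N P" and Q: "is_orth_proj_onto N Q"
  shows "P = Q"
proof
  fix x
  have "Q x * (- 1) \<in> N" using N Q unfolding closed_submodule_def is_orth_proj_onto_def by blast
  hence n: "P x - Q x \<in> N"
    using N P unfolding closed_submodule_def is_orth_proj_onto_def
    by (metis diff_conv_add_uminus mult_minus1_right)
  have "hinner (P x - Q x) (x - Q x) - hinner (P x - Q x) (x - P x) = 0"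
    using n P Q by (simp add: is_orth_proj_onto_def)
  hence "(P x - Q x)\<^sup>\<star> * (P x - Q x) = 0" by (simp add: hinner_def algebra_simps)
  thus "P x = Q x" using cstar_identity[of "P x - Q x"] by simp
qed


section \<open>Generalized Fredholm operators and their index\<close>

text \<open>\<open>mkphi_decomp \<F> F M1 N1 M2 N2 p q\<close>: the pair of decompositions \<open>(M1, N1)\<close>, \<open>(M2, N2)\<close> is an
  \<open>MK\<Phi>\<close>-decomposition for \<open>F\<close>, where \<open>p\<close> and \<open>q\<close> are the (unique) elements of \<open>\<F>\<close> that are identified
  with the orthogonal projections onto \<open>N1\<close> and \<open>N2\<close>. As \<open>F\<close> is a bounded module operator, its
  restriction to \<open>M1\<close> is an isomorphism onto \<open>M2\<close> as soon as it is a bijection.\<close>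

definition mkphi_decomp :: "'a::cstar_algebra set \<Rightarrow> ('a \<Rightarrow> 'a) \<Rightarrow>
    'a set \<Rightarrow> 'a set \<Rightarrow> 'a set \<Rightarrow> 'a set \<Rightarrow> 'a \<Rightarrow> 'a \<Rightarrow> bool" where
  "mkphi_decomp \<F> F M1 N1 M2 N2 p q \<longleftrightarrow>
     direct_decomp M1 N1 \<and> direct_decomp M2 N2 \<and> bij_betw F M1 M2 \<and> F ` N1 \<subseteq> N2 \<and>
     p \<in> \<F> \<and> is_orth_proj_onto N1 (left_mult p) \<and>
     q \<in> \<F> \<and> is_orth_proj_onto N2 (left_mult q)"

definition MKPhi :: "'a::cstar_algebra set \<Rightarrow> ('a \<Rightarrow> 'a) set" where
  "MKPhi \<F> = {F \<in> module_ops. \<exists>M1 N1 M2 N2 p q. mkphi_decomp \<F> F M1 N1 M2 N2 p q}"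

definition mkphi_index :: "'a::cstar_algebra set \<Rightarrow> ('a \<Rightarrow> 'a) \<Rightarrow> ('a set \<times> 'a set) set" where
  "mkphi_index \<F> F = (THE k. \<exists>M1 N1 M2 N2 p q. mkphi_decomp \<F> F M1 N1 M2 N2 p q \<and>
     k = K_class \<F> p \<otimes>\<^bsub>K_group \<F>\<^esub> inv\<^bsub>K_group \<F>\<^esub> (K_class \<F> q))"

end

theory Submission
  imports Defs
begin

text \<open>An \<open>MK\<Phi>\<close>-decomposition of left multiplication by \<open>f\<close> is the same as some \<open>g\<close> with \<open>g f g = g\<close> for
  which the idempotents \<open>1 - g f\<close> and \<open>1 - f g\<close> lie in the ideal, and the index is the difference of
  the classes of their range projections. Given two such pairs \<open>(f, g)\<close>, \<open>(f', g')\<close> with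
  \<open>f' - f\<close> in the ideal, the approximate unit yields a projection \<open>t\<close> with \<open>1 - t\<close> in the ideal
  on whose range \<open>g f\<close>, \<open>g' f'\<close> and \<open>g f'\<close> are close to the identity. Both indices are then computed
  with \<open>[1 - t]\<close> as first term, and the second terms agree because the ranges of \<open>f t\<close> and
  \<open>f' t\<close> have a common complement, up to the idempotents \<open>g f\<close> and \<open>g' f'\<close> in front of \<open>t\<close>.\<close>

section \<open>Inverses and inverse square roots\<close>

lemma scaleR_star: "(r *\<^sub>R x :: 'a::cstar_algebra)\<^sup>\<star> = r *\<^sub>R x\<^sup>\<star>"
  by (metis complex_cnj_complex_of_real scaleC_of_real star_scaleC)

lemma norm_star: "norm (x\<^sup>\<star> :: 'a::cstar_algebra) = norm x"
proof -
  have le: "norm x \<le> norm (x\<^sup>\<star>)" for x :: 'a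
  proof (cases "x = 0")
    case False
    have "norm x * norm x \<le> norm (x\<^sup>\<star>) * norm x"
      using norm_mult_ineq[of "x\<^sup>\<star>" x] by (simp add: cstar_identity power2_eq_square)
    thus ?thesis using False by simp
  qed simp
  show ?thesis using le[of x] le[of "x\<^sup>\<star>"] by (simp add: star_star)
qed

lemma bounded_linear_star: "bounded_linear (star :: 'a::cstar_algebra \<Rightarrow> 'a)"
  by (rule bounded_linear_intro[where K = 1]) (simp_all add: star_add scaleR_star norm_star)

lemma star_power: "(x ^ n :: 'a::cstar_algebra)\<^sup>\<star> = (x\<^sup>\<star>) ^ n"
  by (induction n) (simp_all add: star_one star_mult power_commutes)

lemma star_mult_zero_iff: "x\<^sup>\<star> * x = 0 \<longleftrightarrow> (x::'a::cstar_algebra) = 0"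
  using cstar_identity[of x] by (auto simp: star_zero)

lemma norm_proj_le:
  fixes p :: "'a::cstar_algebra" assumes "is_proj p" shows "norm p \<le> 1"
proof -
  have "norm p * norm p = norm p"
    using assms cstar_identity[of p] by (simp add: is_proj_def power2_eq_square)
  thus ?thesis by (metis mult_cancel_right1 norm_ge_zero order.refl zero_le_one)
qed

lemma is_proj_compl: "is_proj p \<Longrightarrow> is_proj (1 - p)"
  by (simp add: is_proj_def star_diff star_one algebra_simps)

section \<open>Inverses by power series\<close>

lemma neumann:
  fixes x :: "'a::{real_normed_algebra_1,banach}"
  assumes "norm x < 1"
  obtains w where "w * (1 - x) = 1" "(1 - x) * w = 1"
proof -
  let ?w = "\<Sum>n. x ^ n"
  have s: "summable (\<lambda>n. x ^ n)" by (rule complete_algebra_summable_geometric[OF assms])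
  have "?w = 1 + (\<Sum>n. x ^ Suc n)" using suminf_split_head[OF s] by simp
  moreover have "(\<Sum>n. x ^ Suc n) = x * ?w" "(\<Sum>n. x ^ Suc n) = ?w * x"
    using suminf_mult[OF s, of x] suminf_mult2[OF s, of x] by (simp_all add: power_commutes)
  ultimately have "?w = 1 + x * ?w" "?w = 1 + ?w * x" by simp_all
  hence "?w * (1 - x) = 1" "(1 - x) * ?w = 1" by (simp_all add: algebra_simps)
  thus ?thesis using that by blast
qed

text \<open>Since \<open>norm (t * x * t) \<le> norm (x * t)\<close>, the element
  \<open>1 - t * x * t\<close> is invertible. Its inverse commutes with \<open>t\<close>, and cut
  down by \<open>t\<close> it inverts \<open>t * (1 - x) * t\<close> in the corner of
  \<open>t\<close>.\<close>

lemma corner_inverse: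
  fixes x t :: "'a::cstar_algebra"
  assumes t: "is_proj t" and x: "norm (x * t) < 1"
  obtains c where "t * c = c" "c * t = c" "c * (1 - x) * t = t" "t * (1 - x) * c = t"
proof -
  let ?y = "t * x * t"
  have tt: "t * t = t" using t by (simp add: is_proj_def)
  have ttz: "t * (t * z) = t * z" for z using tt by (metis mult.assoc)
  have "norm ?y \<le> norm t * norm (x * t)" by (metis mult.assoc norm_mult_ineq)
  also have "\<dots> \<le> norm (x * t)" by (simp add: mult_left_le_one_le norm_proj_le[OF t])
  finally have "norm ?y < 1" using x by simp
  then obtain w where w: "w * (1 - ?y) = 1" "(1 - ?y) * w = 1" by (rule neumann)
  have c: "(1 - ?y) * t = t * (1 - ?y)" by (simp add: algebra_simps tt ttz)
  have "w * t = w * (t * ((1 - ?y) * w))" by (simp only: w mult_1_right)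
  also have "\<dots> = w * (t * (1 - ?y)) * w" by (simp only: mult.assoc)
  also have "\<dots> = w * ((1 - ?y) * t) * w" by (simp only: c)
  also have "\<dots> = t * w" by (simp add: w flip: mult.assoc)
  finally have wt: "w * t = t * w" .
  have "w * t * (1 - x) * t = w * (1 - ?y) * t" by (simp add: algebra_simps tt)
  moreover have "t * (1 - x) * (t * w) = t * (1 - ?y) * w" by (simp add: algebra_simps tt ttz)
  ultimately show ?thesis
    by (intro that[of "t * w"]) (simp_all add: ttz tt wt w mult.assoc, simp_all add: w wt flip: mult.assoc)
qed

text \<open>\<open>S\<close> is the binomial series of \<open>1 - x\<close> to the power
  \<open>-1/2\<close>. As a limit of real polynomials in \<open>x\<close> it is selfadjoint and
  commutes with everything that commutes with \<open>x\<close>.\<close>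

lemma inverse_sqrt:
  fixes x :: "'a::cstar_algebra"
  assumes x: "norm x < 1" and sa: "x\<^sup>\<star> = x"
  obtains S where "S * S * (1 - x) = 1" "S\<^sup>\<star> = S" "\<And>y. x * y = y * x \<Longrightarrow> S * y = y * S"
proof -
  define k where "k n = (-1) ^ n * ((-1/2 :: real) gchoose n)" for n
  define f where "f n = k n *\<^sub>R x ^ n" for n
  have "ereal (norm (norm x)) < conv_radius (\<lambda>n. (-1/2 :: real) gchoose n)"
    using x by (simp add: conv_radius_gchoose del: divide_minus_left)
  hence "summable (\<lambda>n. norm (((-1/2 :: real) gchoose n) * norm x ^ n))"
    by (rule abs_summable_in_conv_radius)
  hence "summable (\<lambda>n. norm (f n))"
  proof (rule summable_norm_comparison_test[rotated], intro exI allI impI)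
    show "norm (f n) \<le> norm (((-1/2 :: real) gchoose n) * norm x ^ n)" for n
      by (auto simp: f_def k_def abs_mult power_abs intro!: mult_left_mono norm_power_ineq)
  qed
  note sn = this and s = summable_norm_cancel[OF this]
  define S where "S = (\<Sum>n. f n)"
  \<comment> \<open>By Vandermonde the convolved coefficients are
    \<open>(-1) ^ n * ((-1) gchoose n) = 1\<close>, so \<open>S * S\<close> is the geometric
    series.\<close>
  have "(\<Sum>i\<le>n. f i * f (n - i)) = x ^ n" for n
  proof -
    have "(\<Sum>i\<le>n. f i * f (n - i)) = (\<Sum>i\<le>n. (k i * k (n - i)) *\<^sub>R x ^ n)"
      by (rule sum.cong) (simp_all add: f_def mult.commute flip: power_add)
    also have "\<dots> = (\<Sum>i\<le>n. k i * k (n - i)) *\<^sub>R x ^ n" by (simp add: scaleR_sum_left)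
    also have "(\<Sum>i\<le>n. k i * k (n - i))
        = (\<Sum>i\<in>{0..n}. (-1) ^ n * (((-1/2 :: real) gchoose i) * ((-1/2) gchoose (n - i))))"
      by (rule sum.cong) (auto simp: k_def simp flip: power_add)
    also have "\<dots> = (-1) ^ n * ((-1 :: real) gchoose n)"
      by (simp add: gbinomial_Vandermonde flip: sum_distrib_left)
    also have "(-1 :: real) gchoose n = (-1) ^ n"
      using gbinomial_minus[of "1::real" n] by (simp flip: binomial_gbinomial)
    finally show ?thesis by (simp flip: power_add)
  qed
  hence SS: "S * S = (\<Sum>n. x ^ n)" using Cauchy_product[OF sn sn] by (simp add: S_def)
  obtain w where w: "w * (1 - x) = 1" "(1 - x) * w = 1" using neumann[OF x] .
  have sx: "summable (\<lambda>n. x ^ n)" by (rule complete_algebra_summable_geometric[OF x])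
  have "(\<Sum>n. x ^ n) = 1 + (\<Sum>n. x ^ Suc n)" using suminf_split_head[OF sx] by simp
  also have "(\<Sum>n. x ^ Suc n) = (\<Sum>n. x ^ n) * x"
    using suminf_mult2[OF sx, of x] by (simp add: power_commutes)
  finally have "S * S * (1 - x) = 1" by (simp only: SS right_diff_distrib diff_eq_eq mult_1_right)
  moreover have "S\<^sup>\<star> = S"
    unfolding S_def bounded_linear.suminf[OF bounded_linear_star s]
    by (simp add: f_def[abs_def] scaleR_star star_power sa)
  moreover have "S * y = y * S" if "x * y = y * x" for y
  proof -
    have "x ^ n * y = y * x ^ n" for n
      by (rule power_commuting_commutes) (use that in simp)
    thus ?thesis unfolding S_def suminf_mult2[OF s] suminf_mult[OF s, symmetric]
      by (simp add: f_def[abs_def])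
  qed
  ultimately show ?thesis using that by blast
qed

text \<open>A skew element has imaginary spectrum. To stay elementary, \<open>1 + s\<close> is
  written as \<open>(1 + t) - y\<close> with \<open>y = t - s\<close>. The C*-identity gives
  \<open>norm (t * t - s * s)\<close> for the square of \<open>norm y\<close>, and
  \<open>t = (norm s)\<^sup>2\<close> bounds it by \<open>t * t + t\<close>, which is below
  \<open>(1 + t)\<^sup>2\<close>.\<close>

lemma one_plus_skew_invertible:
  fixes s :: "'a::cstar_algebra"
  assumes "s\<^sup>\<star> = - s"
  obtains w where "w * (1 + s) = 1" "(1 + s) * w = 1"
proof -
  define t where "t = (norm s)\<^sup>2"
  define y where "y = t *\<^sub>R 1 - s"
  have t: "t \<ge> 0" by (simp add: t_def)
  have "y\<^sup>\<star> * y = (t * t) *\<^sub>R 1 - s * s"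
    by (simp add: y_def star_diff scaleR_star star_one assms algebra_simps)
  hence "(norm y)\<^sup>2 \<le> t * t + norm s * norm s"
    using norm_triangle_ineq4[of "(t * t) *\<^sub>R (1::'a)" "s * s"] norm_mult_ineq[of s s]
    by (simp flip: cstar_identity)
  also have "\<dots> = t * t + t" by (simp add: t_def power2_eq_square)
  also have "\<dots> < (1 + t)\<^sup>2" using t by (simp add: power2_eq_square algebra_simps)
  finally have "norm y < 1 + t" using t by (simp add: power_less_imp_less_base)
  hence "norm ((1 / (1 + t)) *\<^sub>R y) < 1" using t by simp
  then obtain w where w: "w * (1 - (1 / (1 + t)) *\<^sub>R y) = 1" "(1 - (1 / (1 + t)) *\<^sub>R y) * w = 1"
    by (rule neumann)
  have "1 + s = (1 + t) *\<^sub>R (1 - (1 / (1 + t)) *\<^sub>R y)"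
    using t by (simp add: y_def scaleR_diff_right scaleR_left_distrib)
  with w t show ?thesis by (intro that[of "(1 / (1 + t)) *\<^sub>R w"]) simp_all
qed

section \<open>Range projections and equivalence of idempotents\<close>

text \<open>Lets an equation for \<open>x * y\<close> rewrite inside right-nested products, where
  \<open>x * y\<close> is no longer a subterm.\<close>

lemma mult_extend: "x * y = z \<Longrightarrow> x * (y * w) = z * (w :: 'a::semigroup_mult)"
  by (metis mult.assoc)

text \<open>The equations say that \<open>p\<close> and \<open>e\<close> generate the same right
  ideal: \<open>p\<close> is the orthogonal projection onto the range of the idempotent
  \<open>e\<close>.\<close>

definition range_proj :: "'a::cstar_algebra \<Rightarrow> 'a \<Rightarrow> bool" where
  "range_proj p e \<longleftrightarrow> is_proj p \<and> e * p = p \<and> p * e = e"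

text \<open>Such a \<open>p\<close> satisfies
  \<open>p * (1 + e - e\<^sup>\<star>) = p + e - p = e\<close>, which forces
  \<open>p = e * w\<close> with \<open>w\<close> the inverse of
  \<open>1 + e - e\<^sup>\<star>\<close>.\<close>

lemma range_proj_exists:
  fixes e :: "'a::cstar_algebra"
  assumes e: "e * e = e"
  obtains p where "range_proj p e"
proof -
  let ?s = "e - e\<^sup>\<star>"
  have "?s\<^sup>\<star> = - ?s" by (simp add: star_diff star_star)
  note sk = this
  obtain w where w: "w * (1 + ?s) = 1" "(1 + ?s) * w = 1" using one_plus_skew_invertible[OF sk] .
  have ws: "w\<^sup>\<star> * (1 - ?s) = 1"
    using arg_cong[OF w(2), of star] by (simp add: star_mult star_add star_one star_diff star_star add_diff_eq diff_diff_eq2)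
  have es: "e\<^sup>\<star> * e\<^sup>\<star> = e\<^sup>\<star>" using arg_cong[OF e, of star] by (simp add: star_mult)
  \<comment> \<open>The second form gives selfadjointness of \<open>e * w\<close>, the first gives
    \<open>e * w * e = e\<close>.\<close>
  have E: "(1 - ?s) * e = e\<^sup>\<star> * e" "(1 - ?s) * e = e\<^sup>\<star> * (1 + ?s)"
    by (simp_all add: algebra_simps e es)
  have "e * w = w\<^sup>\<star> * ((1 - ?s) * e) * w" by (simp add: ws flip: mult.assoc)
  also have "\<dots> = w\<^sup>\<star> * e\<^sup>\<star> * ((1 + ?s) * w)" by (simp only: E(2) mult.assoc)
  finally have sa: "e * w = w\<^sup>\<star> * e\<^sup>\<star>" by (simp only: w mult_1_right)
  have "w\<^sup>\<star> * e\<^sup>\<star> * e = w\<^sup>\<star> * ((1 - ?s) * e)" by (simp only: E(1) mult.assoc)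
  hence pe: "e * w * e = e" by (simp add: sa ws flip: mult.assoc)
  have "is_proj (e * w)"
    using pe sa unfolding is_proj_def by (metis mult.assoc star_mult star_star)
  thus ?thesis using that[of "e * w"] pe e by (simp add: range_proj_def flip: mult.assoc)
qed

lemma range_proj_same_range:
  assumes "range_proj p e" "e * e' = e'" "e' * e = e"
  shows "range_proj p e'"
  using assms unfolding range_proj_def by (metis mult.assoc)

lemma range_proj_idem: "range_proj p e \<Longrightarrow> e * e = e"
  unfolding range_proj_def by (metis mult.assoc)

lemma range_proj_self: "is_proj p \<Longrightarrow> range_proj p p"
  by (simp add: range_proj_def is_proj_def)

text \<open>Murray-von Neumann equivalence without the involution. The last four equations place the
  witnesses in the corners between \<open>e\<close> and \<open>f\<close>, which makes both
  idempotent.\<close>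

definition idem_equiv :: "'a::ring_1 \<Rightarrow> 'a \<Rightarrow> bool" where
  "idem_equiv e f \<longleftrightarrow> (\<exists>a b. a * b = e \<and> b * a = f \<and> e * a = a \<and> a * f = a \<and> f * b = b \<and> b * e = b)"

text \<open>Witnesses outside the corners can be cut down: \<open>b * e = f * b\<close> and
  \<open>a * f = e * a\<close> keep both products intact.\<close>

lemma idem_equivI:
  fixes e f :: "'a::ring_1"
  assumes "e * e = e" "f * f = f" "a * b = e" "b * a = f"
  shows "idem_equiv e f"
proof -
  note r = assms(1,2) assms(1,2)[THEN mult_extend]
  have s: "b * e = f * b" "a * f = e * a" by (simp_all add: mult.assoc flip: assms(3,4))
  have s': "b * (e * z) = f * (b * z)" "a * (f * z) = e * (a * z)"
    "a * (b * z) = e * z" "b * (a * z) = f * z" for z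
    by (metis s mult.assoc) (metis s mult.assoc, metis assms(3) mult.assoc, metis assms(4) mult.assoc)
  show ?thesis unfolding idem_equiv_def
    by (rule exI[of _ "e * a * f"], rule exI[of _ "f * b * e"]) (simp add: mult.assoc r s s' assms(3,4))
qed

lemma idem_equiv_idem: "idem_equiv e f \<Longrightarrow> e * e = e \<and> f * f = f"
  unfolding idem_equiv_def by (metis mult.assoc)

lemma idem_equiv_sym: "idem_equiv e f \<Longrightarrow> idem_equiv f e"
  unfolding idem_equiv_def by blast

lemma idem_equiv_trans:
  assumes "idem_equiv e f" "idem_equiv f g" shows "idem_equiv e g"
proof -
  obtain a b c d where r: "a * b = e" "b * a = f" "c * d = f" "d * c = g" "a * f = a" "f * c = c"
     "f * b = b" "d * f = d"
    using assms unfolding idem_equiv_def by blast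
  show ?thesis
  proof (rule idem_equivI)
    show "a * c * (d * b) = e" "d * b * (a * c) = g"
      using r by (metis mult.assoc)+
  qed (use assms idem_equiv_idem in blast)+
qed

lemma range_proj_idem_equiv: "range_proj p e \<Longrightarrow> idem_equiv p e"
  using range_proj_idem[of p e]
  by (intro idem_equivI[of p e e p]) (auto simp: range_proj_def is_proj_def)

text \<open>The witnesses add up; mixed products such as \<open>a * d = a * (f * f') * d\<close>
  vanish by orthogonality.\<close>

lemma idem_equiv_add:
  fixes e e' f f' :: "'a::ring_1"
  assumes "idem_equiv e f" "idem_equiv e' f'" "e * e' = 0" "e' * e = 0" "f * f' = 0" "f' * f = 0"
  shows "idem_equiv (e + e') (f + f')"
proof -
  obtain a b where r: "a * b = e" "b * a = f" "e * a = a" "a * f = a" "f * b = b" "b * e = b"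
    using assms unfolding idem_equiv_def by blast
  obtain c d where r': "c * d = e'" "d * c = f'" "e' * c = c" "c * f' = c" "f' * d = d" "d * e' = d"
    using assms unfolding idem_equiv_def by blast
  have z: "a * d = 0" "c * b = 0" "b * c = 0" "d * a = 0"
  proof -
    have "a * d = a * (f * f') * d" "c * b = c * (f' * f) * b" "b * c = b * (e * e') * c" "d * a = d * (e' * e) * a"
      using r r' by (metis mult.assoc)+
    thus "a * d = 0" "c * b = 0" "b * c = 0" "d * a = 0" by (simp_all add: assms)
  qed
  have i: "e * e = e" "e' * e' = e'" "f * f = f" "f' * f' = f'" using assms idem_equiv_idem by blast+
  show ?thesis
    by (rule idem_equivI[of _ _ "a + c" "b + d"]) (simp_all add: algebra_simps i assms r r' z)
qed

text \<open>The idempotent \<open>\<phi>' d \<psi>\<close> has the kernel of \<open>\<phi> \<psi>\<close> and the range of \<open>\<phi>' \<psi>'\<close>.\<close>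

lemma idem_equiv_compl:
  fixes \<phi> \<psi> \<phi>' \<psi>' t d :: "'a::ring_1"
  assumes r: "\<psi> * \<phi> = t" "\<phi> * t = \<phi>" "t * \<psi> = \<psi>" "\<psi>' * \<phi>' = t" "\<phi>' * t = \<phi>'" "t * \<psi>' = \<psi>'"
    and d: "t * d = d" "d * t = d" "d * (\<psi> * \<phi>') = t" "\<psi> * (\<phi>' * d) = t"
  shows "idem_equiv (1 - \<phi> * \<psi>) (1 - \<phi>' * \<psi>')"
proof -
  note r' = r[THEN mult_extend] d(1,2)[THEN mult_extend]
  have d': "d * (\<psi> * (\<phi>' * z)) = t * z" "\<psi> * (\<phi>' * (d * z)) = t * z" for z
    by (metis d(3) mult.assoc, metis d(4) mult.assoc)
  \<comment> \<open>Equal kernels give \<open>1 - ?j\<close> the range of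
    \<open>1 - \<phi> * \<psi>\<close>, equal ranges give it the kernel of
    \<open>1 - \<phi>' * \<psi>'\<close>. The witnesses compose the two resulting
    equivalences.\<close>
  let ?j = "\<phi>' * (d * \<psi>)"
  show ?thesis
    by (rule idem_equivI[of _ _ "1 - ?j" "(1 - \<phi>' * \<psi>') * (1 - \<phi> * \<psi>)"])
       (simp_all add: algebra_simps r d r' d')
qed

section \<open>Murray-von Neumann classes of idempotents in the ideal\<close>

context
  fixes \<F> :: "'a::cstar_algebra set"
  assumes ft: "finite_type_ideal \<F>"
begin

section \<open>Equivalence of close projections and idempotents\<close>

lemma F_diff: "x \<in> \<F> \<Longrightarrow> y \<in> \<F> \<Longrightarrow> x - y \<in> \<F>"
  using F_ideal(3)[OF ft, of x "-1 * y"] F_ideal(1)[OF ft, of y "-1"] by simp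

lemma range_proj_in:
  assumes "range_proj p e" "e \<in> \<F>" shows "p \<in> Projs \<F>"
  using assms F_ideal(2)[OF ft, of e p] by (simp add: Projs_def range_proj_def)

lemma mvn_trans: "(p, q) \<in> mvn_rel \<F> \<Longrightarrow> (q, r) \<in> mvn_rel \<F> \<Longrightarrow> (p, r) \<in> mvn_rel \<F>"
  using mvn_equiv[OF ft] unfolding equiv_def by (meson transD)

lemma mvn_sym: "(p, q) \<in> mvn_rel \<F> \<Longrightarrow> (q, p) \<in> mvn_rel \<F>"
  using mvn_equiv[OF ft] unfolding equiv_def by (meson symD)

text \<open>The partial isometry is the polar part of \<open>p * q\<close>, with \<open>S\<close> as
  inverse square root of \<open>q * p * q\<close>. The first bound makes \<open>q * p * q\<close>
  invertible in the corner of \<open>q\<close>, the second makes the polar part reach all of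
  \<open>p\<close>.\<close>

lemma mvn_close_projs:
  assumes P: "p \<in> Projs \<F>" "q \<in> Projs \<F>"
    and n1: "norm ((1 - p) * q) < 1" and n2: "norm ((1 - q) * p) < 1"
  shows "(p, q) \<in> mvn_rel \<F>"
proof -
  have p: "p * p = p" "p\<^sup>\<star> = p" and q: "q * q = q" "q\<^sup>\<star> = q" using P by (auto simp: Projs_def is_proj_def)
  note r = p q p(1)[THEN mult_extend] q(1)[THEN mult_extend]
  have small: "norm (v - v * u * v) < 1"
    if "u * u = u" "u\<^sup>\<star> = u" "v * v = v" "v\<^sup>\<star> = v" "norm ((1 - u) * v) < 1" for u v :: 'a
  proof -
    have "((1 - u) * v)\<^sup>\<star> * ((1 - u) * v) = v - v * u * v"
      using that by (simp add: star_mult star_diff star_one algebra_simps that(1,3)[THEN mult_extend])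
    hence "norm (v - v * u * v) = (norm ((1 - u) * v))\<^sup>2" by (metis cstar_identity)
    thus ?thesis using that(5) by (simp add: power_less_one_iff abs_square_less_1)
  qed
  \<comment> \<open>Here \<open>1 - ?x = (1 - q) + q * p * q\<close>, so \<open>S * S\<close>
    inverts \<open>q * p * q\<close> in the corner of \<open>q\<close>.\<close>
  let ?x = "q - q * p * q"
  have xs: "?x\<^sup>\<star> = ?x" by (simp add: star_diff star_mult r mult.assoc)
  obtain S where S: "S * S * (1 - ?x) = 1" "S\<^sup>\<star> = S" "\<And>y. ?x * y = y * ?x \<Longrightarrow> S * y = y * S"
    using inverse_sqrt[OF small[OF p q n1] xs] by blast
  have Sq: "S * q = q * S" by (rule S(3)) (simp add: algebra_simps r)
  have Sqpq: "S * (q * p * q) = q * p * q * S" by (rule S(3)) (simp add: algebra_simps r)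
  have "S * S * (q * p * q) = S * S * (1 - ?x) * q" by (simp add: algebra_simps r)
  hence SS: "S * S * (q * p * q) = q" by (simp add: S(1))
  define v where "v = p * q * S"
  have vs: "v\<^sup>\<star> = S * q * p" by (simp add: v_def star_mult S r mult.assoc)
  have "v\<^sup>\<star> * v = S * (q * p * q * S)" by (simp only: vs) (simp add: v_def mult.assoc r)
  also have "q * p * q * S = S * (q * p * q)" by (rule Sqpq[symmetric])
  also have "S * (S * (q * p * q)) = q" using SS by (simp only: mult.assoc)
  finally have vv: "v\<^sup>\<star> * v = q" .
  define w where "w = v * v\<^sup>\<star>"
  have w0: "w = p * (q * (S * (S * (q * p))))" unfolding w_def vs by (simp add: v_def mult.assoc)
  have wp: "w * p = w" by (simp add: w0 mult.assoc r)
  have "w * (p * q) = p * q * (S * S * (q * p * q))" by (simp add: w0 mult.assoc r)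
  hence wpq: "w * (p * q) = p * q" unfolding SS by (simp add: mult.assoc r)
  \<comment> \<open>\<open>w\<close> fixes \<open>p * q\<close>, so \<open>p - w\<close> annihilates
    it. As \<open>p - p * q * p\<close> has norm below \<open>1\<close>, the identity forces
    \<open>p = w\<close>.\<close>
  have "(p - w) * (p - p * q * p) = p - w"
    using wpq[THEN mult_extend, of p] by (simp add: algebra_simps r wp)
  hence "norm (p - w) \<le> norm (p - w) * norm (p - p * q * p)" by (metis norm_mult_ineq)
  moreover have "norm (p - p * q * p) < 1" by (rule small[OF q p n2])
  ultimately have "p - w = 0" by (simp add: mult_le_cancel_left1)
  thus ?thesis using P vv unfolding mvn_rel_def w_def by auto
qed

text \<open>From \<open>u = e' * u\<close> and \<open>(1 - v) * f' = 0\<close> follows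
  \<open>(1 - v) * u = (1 - v) * (e' - f') * u\<close>, so range projections of close idempotents
  satisfy the bounds for projections.\<close>

lemma mvn_close_idems:
  assumes R: "range_proj p e" "range_proj q f" and F: "e \<in> \<F>" "f \<in> \<F>" and n: "norm (e - f) < 1"
  shows "(p, q) \<in> mvn_rel \<F>"
proof -
  have *: "norm ((1 - v) * u) < 1" if "range_proj u e'" "range_proj v f'" "norm (e' - f') < 1" for u v e' f'
  proof -
    have U: "is_proj u" "is_proj v" "e' * u = u" "v * f' = f'" using that by (auto simp: range_proj_def)
    have "(1 - v) * u = (1 - v) * ((e' - f') * u)"
      by (simp add: algebra_simps U U(4)[THEN mult_extend])
    also have "norm \<dots> \<le> norm ((e' - f') * u)"
      using norm_mult_ineq[of "1 - v" "(e' - f') * u"] norm_proj_le[OF is_proj_compl[OF U(2)]]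
      by (meson mult_left_le_one_le norm_ge_zero order_trans)
    also have "\<dots> \<le> norm (e' - f')"
      using norm_mult_ineq[of "e' - f'" u] norm_proj_le[OF U(1)]
      by (meson mult_right_le_one_le norm_ge_zero order_trans)
    finally show ?thesis using that(3) by simp
  qed
  show ?thesis
    using mvn_close_projs[OF range_proj_in[OF R(1) F(1)] range_proj_in[OF R(2) F(2)]]
      *[OF R] *[OF R(2,1)] n by (simp add: norm_minus_commute)
qed

text \<open>The segment is cut into \<open>N > norm n\<close> steps; neighbouring idempotents then
  differ by less than \<open>1\<close>.\<close>

lemma mvn_segment:
  assumes R: "range_proj p e" "range_proj q (e + n)" and F: "e \<in> \<F>" "n \<in> \<F>"
    and idem: "\<And>t::real. (e + t *\<^sub>R n) * (e + t *\<^sub>R n) = e + t *\<^sub>R n"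
  shows "(p, q) \<in> mvn_rel \<F>"
proof -
  obtain N :: nat where N: "norm n < real N" using reals_Archimedean2 by blast
  hence N0: "N > 0" by (metis norm_ge_zero not_less of_nat_0 gr0I)
  define E where "E i = e + (real i / real N) *\<^sub>R n" for i
  have "(real i / real N) *\<^sub>R n \<in> \<F>" for i
    using F_ideal(2)[OF ft F(2), of "(real i / real N) *\<^sub>R 1"] by simp
  hence EF: "E i \<in> \<F>" for i unfolding E_def using F_ideal(3)[OF ft F(1)] by blast
  have "\<exists>r. range_proj r (E i)" for i
    using range_proj_exists[of "E i"] idem unfolding E_def by metis
  then obtain r where r: "\<And>i. range_proj (r i) (E i)" by metis
  have step: "norm (E i - E (Suc i)) < 1" for i
  proof -
    have "E i - E (Suc i) = - ((1 / real N) *\<^sub>R n)"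
      by (simp add: E_def add_divide_distrib scaleR_add_left)
    hence "norm (E i - E (Suc i)) = norm n / real N"
      by (simp only: norm_minus_cancel norm_scaleR) simp
    thus ?thesis using N N0 by simp
  qed
  have "(p, r i) \<in> mvn_rel \<F>" for i
  proof (induction i)
    case 0
    show ?case by (rule mvn_close_idems[OF R(1) r[of 0] F(1) EF]) (simp add: E_def)
  next
    case (Suc i)
    thus ?case using mvn_trans mvn_close_idems[OF r r EF EF step] by blast
  qed
  moreover have "(r N, q) \<in> mvn_rel \<F>"
    by (rule mvn_close_idems[OF r R(2) EF]) (use N0 F F_ideal(3)[OF ft] in \<open>simp_all add: E_def\<close>)
  ultimately show ?thesis using mvn_trans by blast
qed

text \<open>Orthogonal equivalent projections \<open>p\<close>, \<open>q\<close> are joined by segments of idempotents to two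
  idempotents whose common range is the graph of the equivalence. This replaces the polar
  decomposition.\<close>

lemma mvn_of_idem_equiv:
  assumes P: "p \<in> Projs \<F>" "q \<in> Projs \<F>" and eq: "idem_equiv p q"
  shows "(p, q) \<in> mvn_rel \<F>"
proof -
  obtain p' where p': "(p, p') \<in> mvn_rel \<F>" "q \<bottom>\<^sub>p p'" using orth_rep[OF ft P(2,1)] .
  hence P': "p' \<in> Projs \<F>" by (auto simp: mvn_rel_def)
  obtain v where "v * v\<^sup>\<star> = p" "v\<^sup>\<star> * v = p'" using p' by (auto simp: mvn_rel_def)
  hence "idem_equiv p p'"
    by (intro idem_equivI[of _ _ v "v\<^sup>\<star>"]) (use P P' in \<open>auto simp: Projs_def is_proj_def\<close>)
  hence "idem_equiv p' q" using eq idem_equiv_trans idem_equiv_sym by blast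
  then obtain a b where r: "a * b = p'" "b * a = q" "p' * a = a" "a * q = a" "q * b = b" "b * p' = b"
    unfolding idem_equiv_def by blast
  have pr: "is_proj p'" "is_proj q" using P P' by (auto simp: Projs_def)
  have F: "p' \<in> \<F>" "q \<in> \<F>" using P P' by (auto simp: Projs_def)
  have o: "q * p' = 0" "p' * q = 0"
    using p'(2) proj_orth_commute[OF pr] by (simp_all add: proj_orth_def)
  have i: "p' * p' = p'" "q * q = q" using pr by (auto simp: is_proj_def)
  have z: "p' * b = 0" "a * a = 0" "b * b = 0" "q * a = 0" "a * p' = 0" "b * q = 0"
    using r o by (metis mult.assoc mult_zero_left mult_zero_right)+
  \<comment> \<open>\<open>b\<close> maps the range of \<open>p'\<close> to that of \<open>q\<close>
    and \<open>a\<close> inverts it, so \<open>p' + b\<close> and \<open>q + a\<close> both have the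
    graph of \<open>b\<close> as range. Orthogonality of \<open>p'\<close> and \<open>q\<close>
    makes every \<open>p' + t b\<close> and \<open>q + t a\<close> with real \<open>t\<close>
    idempotent.\<close>
  have "(p' + b) * (p' + b) = p' + b" by (simp add: algebra_simps i z r)
  then obtain s where s: "range_proj s (p' + b)" by (rule range_proj_exists)
  have s': "range_proj s (q + a)"
    by (rule range_proj_same_range[OF s]) (simp_all add: algebra_simps i z r o)
  have "(p', s) \<in> mvn_rel \<F>"
    by (rule mvn_segment[OF range_proj_self[OF pr(1)] s])
      (use F r(5) F_ideal(2)[OF ft F(2), of b] in \<open>simp_all add: algebra_simps i z r\<close>)
  moreover have "(q, s) \<in> mvn_rel \<F>"
    by (rule mvn_segment[OF range_proj_self[OF pr(2)] s'])
      (use F r(3) F_ideal(2)[OF ft F(1), of a] in \<open>simp_all add: algebra_simps i z r\<close>)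
  ultimately show ?thesis using p'(1) mvn_trans mvn_sym by blast
qed

section \<open>Semigroup classes of idempotents\<close>

lemma class_eq:
  assumes "range_proj p e" "range_proj q f" "e \<in> \<F>" "f \<in> \<F>" "idem_equiv e f"
  shows "mvn_rel \<F> `` {p} = mvn_rel \<F> `` {q}"
proof -
  have "idem_equiv p q"
    using assms range_proj_idem_equiv idem_equiv_trans idem_equiv_sym by blast
  hence "(p, q) \<in> mvn_rel \<F>" using mvn_of_idem_equiv assms range_proj_in by blast
  thus ?thesis by (rule equiv_class_eq[OF mvn_equiv[OF ft]])
qed

text \<open>Range projections of orthogonal idempotents need not be orthogonal. An equivalent copy
  \<open>q'\<close> of \<open>q\<close> orthogonal to \<open>p\<close> repairs this, and
  \<open>e + f\<close> is equivalent to \<open>p + q'\<close>.\<close>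

lemma class_add:
  assumes R: "range_proj p e" "range_proj q f" "range_proj r (e + f)"
    and F: "e \<in> \<F>" "f \<in> \<F>" and o: "e * f = 0" "f * e = 0"
  shows "S_add \<F> (mvn_rel \<F> `` {p}) (mvn_rel \<F> `` {q}) = mvn_rel \<F> `` {r}"
proof -
  have P: "p \<in> Projs \<F>" "q \<in> Projs \<F>" using range_proj_in R F by blast+
  obtain q' where q': "(q, q') \<in> mvn_rel \<F>" "p \<bottom>\<^sub>p q'" using orth_rep[OF ft P] .
  hence Q': "q' \<in> Projs \<F>" by (auto simp: mvn_rel_def)
  obtain v where "v * v\<^sup>\<star> = q" "v\<^sup>\<star> * v = q'" using q' by (auto simp: mvn_rel_def)
  hence "idem_equiv q q'"
    by (intro idem_equivI[of _ _ v "v\<^sup>\<star>"]) (use P Q' in \<open>auto simp: Projs_def is_proj_def\<close>)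
  hence 1: "idem_equiv f q'" using range_proj_idem_equiv[OF R(2)] idem_equiv_trans idem_equiv_sym by blast
  have 2: "idem_equiv e p" using range_proj_idem_equiv[OF R(1)] idem_equiv_sym by blast
  have o': "p * q' = 0" "q' * p = 0"
    using q'(2) proj_orth_commute[of p q'] P Q' by (auto simp: proj_orth_def Projs_def)
  have PQ: "p + q' \<in> Projs \<F>" using Projs_add[OF ft P(1) Q' q'(2)] .
  have "mvn_rel \<F> `` {r} = mvn_rel \<F> `` {p + q'}"
    by (rule class_eq[OF R(3) range_proj_self])
      (use PQ F F_ideal(3)[OF ft] idem_equiv_add[OF 2 1 o o'] in \<open>auto simp: Projs_def\<close>)
  thus ?thesis using S_add_eq[OF ft mvn_refl[OF ft P(1)] q'] by simp
qed

end

section \<open>Independence of the index\<close>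

text \<open>Commutativity moves \<open>l\<close> next to the witness \<open>e\<close>: the witness
  \<open>add e l\<close> serves for the pair without \<open>l\<close>, and conversely
  \<open>e\<close> can be kept.\<close>

lemma groth_rel_add_right:
  assumes cl: "\<And>a b. a \<in> S \<Longrightarrow> b \<in> S \<Longrightarrow> add a b \<in> S"
    and as: "\<And>a b c. a \<in> S \<Longrightarrow> b \<in> S \<Longrightarrow> c \<in> S \<Longrightarrow> add (add a b) c = add a (add b c)"
    and cm: "\<And>a b. a \<in> S \<Longrightarrow> b \<in> S \<Longrightarrow> add a b = add b a"
    and S: "a \<in> S" "b \<in> S" "l \<in> S"
  shows "groth_rel S add `` {(add a l, add b l)} = groth_rel S add `` {(a, b)}"
proof -
  have lc: "add a (add b c) = add b (add a c)" if "a \<in> S" "b \<in> S" "c \<in> S" for a b c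
    by (metis as cm that)
  have sh: "add (add (add x l) y) e = add (add x y) (add e l)"
     "add (add y (add x l)) e = add (add y x) (add e l)" if "x \<in> S" "y \<in> S" "e \<in> S" for x y e
    using that S by (simp_all add: as cm lc cl)
  have "(\<exists>e\<in>S. add (add (add a l) d) e = add (add c (add b l)) e)
      \<longleftrightarrow> (\<exists>e\<in>S. add (add a d) e = add (add c b) e)" if cd: "c \<in> S" "d \<in> S" for c d
  proof
    assume "\<exists>e\<in>S. add (add (add a l) d) e = add (add c (add b l)) e"
    thus "\<exists>e\<in>S. add (add a d) e = add (add c b) e" using sh S cd cl by metis
  next
    assume "\<exists>e\<in>S. add (add a d) e = add (add c b) e"
    then obtain e where e: "e \<in> S" "add (add a d) e = add (add c b) e" by blast
    have "add (add a d) (add e l) = add (add c b) (add e l)"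
      using e S cd cl as by metis
    thus "\<exists>e\<in>S. add (add (add a l) d) e = add (add c (add b l)) e" using sh S cd e(1) by metis
  qed
  thus ?thesis using S cl by (auto simp: groth_rel_def)
qed

context
  fixes \<F> :: "'a::cstar_algebra set"
  assumes ft: "finite_type_ideal \<F>"
begin

lemma F_compl_mult:
  assumes "1 - x \<in> \<F>" "1 - y \<in> \<F>" shows "1 - x * y \<in> \<F>"
proof -
  have "1 - x * y = (1 - x) + x * (1 - y)" by (simp add: algebra_simps)
  thus ?thesis using assms F_ideal[OF ft] by metis
qed

text \<open>Modulo the ideal, \<open>t\<close> is \<open>1\<close> and \<open>x\<close> is
  \<open>0\<close>, so \<open>c * (1 - x) * t = t\<close> reads \<open>c = 1\<close>.\<close>

lemma F_corner_inverse:
  assumes "1 - t \<in> \<F>" "x \<in> \<F>" "c * t = c" "c * (1 - x) * t = t"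
  shows "1 - c \<in> \<F>"
proof -
  have "1 - c = (1 - t) - c * x * t" using assms(3,4) by (simp add: algebra_simps)
  thus ?thesis using F_diff[OF ft] F_ideal[OF ft] assms(1,2) by metis
qed

text \<open>The approximate unit enters here: \<open>t = 1 - p i\<close> for an index
  \<open>i\<close> late enough for all of the finite set \<open>X\<close>.\<close>

lemma small_compl_proj:
  assumes X: "finite X" "X \<subseteq> \<F>"
  obtains t where "is_proj t" "1 - t \<in> \<F>" "\<And>x. x \<in> X \<Longrightarrow> norm (x * t) < 1"
proof -
  obtain I :: "'a set" and rel p where u: "proj_approx_unit \<F> I rel p"
    using ft unfolding finite_type_ideal_def by blast
  have dir: "directed_index I rel" using u unfolding proj_approx_unit_def by blast
  have "\<forall>\<^sub>F i in net_filter I rel. norm (x * p i - x) < 1" if "x \<in> \<F>" for x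
    using u that order_tendstoD(2)[of "\<lambda>i. norm (x * p i - x)" 0 _ 1]
    unfolding proj_approx_unit_def by simp
  hence "\<forall>\<^sub>F i in net_filter I rel. \<forall>x\<in>X. norm (x * p i - x) < 1"
    using X by (intro eventually_ball_finite) auto
  then obtain i where i: "i \<in> I" "\<forall>j\<in>I. rel i j \<longrightarrow> (\<forall>x\<in>X. norm (x * p j - x) < 1)"
    unfolding eventually_net_filter[OF dir] by blast
  have "rel i i" using i dir unfolding directed_index_def by blast
  hence n: "norm (x * p i - x) < 1" if "x \<in> X" for x using i that by blast
  have pi: "p i \<in> \<F>" "is_proj (p i)" using u i unfolding proj_approx_unit_def by blast+
  show ?thesis
  proof (rule that[of "1 - p i"])
    show "norm (x * (1 - p i)) < 1" if "x \<in> X" for x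
      using n[OF that] norm_minus_commute[of x "x * p i"] by (simp add: right_diff_distrib)
  qed (use pi is_proj_compl in auto)
qed

lemma class_in_carrier: "range_proj p e \<Longrightarrow> e \<in> \<F> \<Longrightarrow> mvn_rel \<F> `` {p} \<in> S_carrier \<F>"
  using range_proj_in[OF ft] by (auto simp: S_carrier_def quotient_def)

text \<open>The kernel of \<open>g f\<close> may be enlarged to a complement of \<open>g f t\<close>, at the cost of adding
  equivalent summands to both classes.\<close>

lemma class_corner:
  fixes f g t :: 'a
  assumes gfg: "g * f * g = g" and F: "1 - g * f \<in> \<F>" "1 - f * g \<in> \<F>" "1 - t \<in> \<F>"
    and t: "t * t = t" "is_proj t"
    and c: "t * c = c" "c * t = c" "c * (g * f) * t = t"
    and R: "range_proj p (1 - g * f)" "range_proj q (1 - f * g)"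
      "range_proj z (1 - f * (g * f) * t * (c * g))"
  shows "1 - f * (g * f) * t * (c * g) \<in> \<F> \<and>
    groth_rel (S_carrier \<F>) (S_add \<F>) `` {(mvn_rel \<F> `` {p}, mvn_rel \<F> `` {q})}
    = groth_rel (S_carrier \<F>) (S_add \<F>) `` {(mvn_rel \<F> `` {1 - t}, mvn_rel \<F> `` {z})}"
proof -
  let ?m = "\<lambda>p. mvn_rel \<F> `` {p}"
  define e where "e = g * f"
  \<comment> \<open>Since \<open>s = (e * t) * (c * e)\<close> and
    \<open>(c * e) * (e * t) = t\<close>, this is an idempotent below \<open>e\<close> with the
    range of \<open>e * t\<close>. The summand to be added is \<open>e - s\<close> on the source
    side and its copy \<open>u\<close> on the target side.\<close>
  define s where "s = e * c * e"
  define u where "u = f * (e - s) * g"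
  have r: "e * g = g" "e * e = e" "f * e = f * g * f"
    using gfg unfolding e_def by (simp_all add: mult.assoc) (metis mult.assoc)
  have gf: "g * f = e" "g * (f * y) = e * y" for y by (simp_all add: e_def mult.assoc)
  have ce: "c * (e * t) = t" "t * (c * y) = c * y" "c * (t * y) = c * y" "c * (e * (t * y)) = t * y" for y
    using c by (simp_all add: e_def flip: mult.assoc)
  note x = r(1,2) r(1,2)[THEN mult_extend] gf ce t c(1,2)
  have cec: "c * (e * c) = c" by (metis c(1) ce(4))
  hence cec': "c * (e * (c * y)) = c * y" for y by (metis mult.assoc)
  note x = x cec cec'
  have es: "e * s = s" "s * e = s" "s * s = s" by (simp_all add: s_def mult.assoc x)
  note x = x es es[THEN mult_extend]
  have cF: "1 - c \<in> \<F>"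
    by (rule F_corner_inverse[OF F(3,1) c(2)]) (use c(3) in simp)
  have eF: "1 - e \<in> \<F>" using F(1) by (simp add: e_def)
  have sF: "1 - s \<in> \<F>" unfolding s_def by (intro F_compl_mult eF cF)
  have esF: "e - s \<in> \<F>" using F_diff[OF ft sF eF] by simp
  have uF: "u \<in> \<F>" unfolding u_def using F_ideal[OF ft] esF by blast
  have feg: "f * (e * g) = f * g" "f * (s * g) = f * (e * (c * g))" by (simp_all add: x s_def mult.assoc)
  have zsum: "1 - f * (g * f) * t * (c * g) = (1 - f * g) + u"
    unfolding u_def by (simp add: algebra_simps x feg)
  have ui: "u * u = u" unfolding u_def by (simp add: algebra_simps x)
  have Rs: "range_proj (1 - t) (1 - t)" using range_proj_self is_proj_compl t by blast
  have esi: "(e - s) * (e - s) = e - s" by (simp add: algebra_simps x)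
  obtain l where l: "range_proj l (e - s)" using range_proj_exists[OF esi] .
  obtain k where k: "range_proj k u" using range_proj_exists[OF ui] .
  have "(1 - s) * (1 - s) = 1 - s" by (simp add: algebra_simps x)
  then obtain h where h: "range_proj h (1 - s)" by (rule range_proj_exists)
  \<comment> \<open>The second pair of maps is taken to be \<open>t\<close>, \<open>t\<close>; then
    \<open>c * e * t = t\<close> allows \<open>d = t\<close>.\<close>
  have "idem_equiv (1 - (e * t) * (c * e)) (1 - t * t)"
    by (rule idem_equiv_compl[where d = t]) (simp_all add: mult.assoc x)
  hence "idem_equiv (1 - s) (1 - t)" by (simp add: s_def mult.assoc x)
  hence 1: "?m h = ?m (1 - t)" by (rule class_eq[OF ft h Rs sF F(3)])
  have "idem_equiv (e - s) u"
    by (rule idem_equivI[of _ _ "(e - s) * g" "f * (e - s)"])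
       (simp_all add: esi ui u_def algebra_simps x)
  hence 2: "?m l = ?m k" by (rule class_eq[OF ft l k esF uF])
  have 3: "S_add \<F> (?m p) (?m l) = ?m h"
    by (rule class_add[OF ft R(1) l _ F(1) esF]) (use h in \<open>simp_all add: algebra_simps x\<close>)
  have 4: "S_add \<F> (?m q) (?m k) = ?m z"
    by (rule class_add[OF ft R(2) k _ F(2) uF])
      (use R(3) in \<open>simp_all only: zsum\<close>, simp_all add: u_def algebra_simps x)
  \<comment> \<open>The common class \<open>?m l = ?m k\<close> cancels, where
    \<open>1 - s = (1 - e) + (e - s)\<close> on the left and \<open>zsum\<close> on the right give
    the enlarged classes.\<close>
  have "groth_rel (S_carrier \<F>) (S_add \<F>) `` {(S_add \<F> (?m p) (?m l), S_add \<F> (?m q) (?m l))}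
      = groth_rel (S_carrier \<F>) (S_add \<F>) `` {(?m p, ?m q)}"
    by (rule groth_rel_add_right[OF S_closed[OF ft] S_assoc[OF ft] S_comm[OF ft]])
      (use class_in_carrier R l F esF in blast)+
  moreover have "1 - f * (g * f) * t * (c * g) \<in> \<F>"
    unfolding zsum by (rule F_ideal(3)[OF ft F(2) uF])
  ultimately show ?thesis using 1 2 3 4 by simp
qed

text \<open>For \<open>t\<close> small enough, \<open>f g f t\<close> and \<open>f' g' f' t\<close> have left inverses and their ranges have
  equivalent complements, because \<open>g f' g' f' t\<close> is close to \<open>t\<close>.\<close>

lemma index_unique:
  fixes f g f' g' :: 'a
  assumes g: "g * f * g = g" "1 - g * f \<in> \<F>" "1 - f * g \<in> \<F>"
    and R: "range_proj p (1 - g * f)" "range_proj q (1 - f * g)"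
    and g': "g' * f' * g' = g'" "1 - g' * f' \<in> \<F>" "1 - f' * g' \<in> \<F>"
    and R': "range_proj p' (1 - g' * f')" "range_proj q' (1 - f' * g')"
    and d: "f' - f \<in> \<F>"
  shows "groth_rel (S_carrier \<F>) (S_add \<F>) `` {(mvn_rel \<F> `` {p}, mvn_rel \<F> `` {q})}
    = groth_rel (S_carrier \<F>) (S_add \<F>) `` {(mvn_rel \<F> `` {p'}, mvn_rel \<F> `` {q'})}"
proof -
  define e where "e = g * f"
  define e' where "e' = g' * f'"
  \<comment> \<open>Modulo the ideal \<open>f'\<close> equals \<open>f\<close>, and
    \<open>g * f\<close> and \<open>e'\<close> equal \<open>1\<close>, so \<open>y\<close> lies in
    the ideal and is small on the range of a suitable \<open>t\<close>.\<close>
  define y where "y = 1 - g * f' * e'"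
  have "y = (1 - g * f) - g * (f' - f) + g * f' * (1 - e')" by (simp add: y_def algebra_simps)
  hence yF: "y \<in> \<F>" using F_diff[OF ft] F_ideal[OF ft] g(2) g'(2) d unfolding e'_def by metis
  obtain t where t: "is_proj t" "1 - t \<in> \<F>" and small: "\<And>x. x \<in> {1 - e, 1 - e', y} \<Longrightarrow> norm (x * t) < 1"
    using small_compl_proj[of "{1 - e, 1 - e', y}"] g(2) g'(2) yF unfolding e_def e'_def by auto
  have tt: "t * t = t" using t by (simp add: is_proj_def)
  obtain c where c: "t * c = c" "c * t = c" "c * e * t = t" "t * e * c = t"
    using corner_inverse[OF t(1) small[of "1 - e"]] by auto
  obtain c' where c': "t * c' = c'" "c' * t = c'" "c' * e' * t = t" "t * e' * c' = t"
    using corner_inverse[OF t(1) small[of "1 - e'"]] by auto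
  obtain k where k: "t * k = k" "k * t = k" "k * (g * f' * e') * t = t" "t * (g * f' * e') * k = t"
    using corner_inverse[OF t(1) small[of y]] by (auto simp: y_def)
  \<comment> \<open>Idempotent because \<open>c * g\<close> is a left inverse of
    \<open>f * e * t\<close> relative to \<open>t\<close>.\<close>
  have i: "f * e * t * (c * g) * (f * e * t * (c * g)) = f * e * t * (c * g)"
    if "g * f * g = g" "c * e * t = t" "e = g * f" for f g e c
  proof -
    have "e * e = e" using that by (metis mult.assoc)
    moreover have "c * g * (f * e * t) = c * (e * e) * t" using that(3) by (simp add: mult.assoc)
    ultimately have "c * g * (f * e * t) = t" using that(2) by simp
    moreover have "f * e * t * (c * g) * (f * e * t * (c * g)) = f * e * t * (c * g * (f * e * t)) * (c * g)"
      by (simp only: mult.assoc)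
    ultimately show ?thesis by (simp add: mult.assoc tt[THEN mult_extend])
  qed
  obtain z where z: "range_proj z (1 - f * e * t * (c * g))"
    using range_proj_exists[of "1 - f * e * t * (c * g)"] i[OF g(1) c(3) e_def] by (auto simp: algebra_simps)
  obtain z' where z': "range_proj z' (1 - f' * e' * t * (c' * g'))"
    using range_proj_exists[of "1 - f' * e' * t * (c' * g')"] i[OF g'(1) c'(3) e'_def] by (auto simp: algebra_simps)
  note C = class_corner[OF g t(2) tt t(1) c(1) c(2) c(3)[unfolded e_def] R z[unfolded e_def]]
  note C' = class_corner[OF g' t(2) tt t(1) c'(1) c'(2) c'(3)[unfolded e'_def] R' z'[unfolded e'_def]]
  have ee: "e * e = e" "e' * e' = e'" using g(1) g'(1) unfolding e_def e'_def by (metis mult.assoc)+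
  \<comment> \<open>The corner element \<open>c * g * (f' * e' * t)\<close> has to be inverted. As
    \<open>c\<close> inverts \<open>t * e * t\<close> and \<open>k\<close> inverts
    \<open>t * (g * f' * e') * t\<close>, its inverse is \<open>k * e * t\<close>.\<close>
  have "idem_equiv (1 - (f * e * t) * (c * g)) (1 - (f' * e' * t) * (c' * g'))"
  proof (rule idem_equiv_compl[where d = "k * e * t"])
    have "c * g * (f * e * t) = c * (e * e) * t" "c' * g' * (f' * e' * t) = c' * (e' * e') * t"
      by (simp_all add: e_def e'_def mult.assoc)
    thus "c * g * (f * e * t) = t" "c' * g' * (f' * e' * t) = t" using c(3) c'(3) ee by simp_all
    show "f * e * t * t = f * e * t" "f' * e' * t * t = f' * e' * t" by (simp_all add: mult.assoc tt)
    have x: "t * (c * y) = c * y" "t * (c' * y) = c' * y" "t * (k * y) = k * y"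
      "k * (t * y) = k * y" "c * (t * y) = c * y" for y
      using c(1,2) c'(1) k(1,2) by (simp_all flip: mult.assoc)
    show "t * (c * g) = c * g" "t * (c' * g') = c' * g'" by (simp_all add: x)
    show "t * (k * e * t) = k * e * t" by (simp add: x mult.assoc)
    show "k * e * t * t = k * e * t" by (simp add: mult.assoc tt)
    have "k * e * t * (c * g * (f' * e' * t)) = k * (t * e * c) * (g * f' * e') * t"
      by (simp add: x mult.assoc)
    thus "k * e * t * (c * g * (f' * e' * t)) = t" using c(4) k(2) k(3) by simp
    have "c * g * (f' * e' * t * (k * e * t)) = c * (t * (g * f' * e') * k) * e * t"
      by (simp add: x mult.assoc)
    thus "c * g * (f' * e' * t * (k * e * t)) = t" using c(2) c(3) k(4) by simp
  qed
  hence "mvn_rel \<F> `` {z} = mvn_rel \<F> `` {z'}"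
    using class_eq[OF ft z z'] C C' unfolding e_def e'_def by blast
  thus ?thesis using C C' by simp
qed

text \<open>Modulo the ideal, \<open>g\<close> still inverts \<open>f + K\<close>. Thus
  \<open>g * (f + K) = 1 - x\<close> with \<open>x\<close> in the ideal, and
  \<open>h = c * g\<close> corrects \<open>g\<close> by the inverse \<open>c\<close> of
  \<open>1 - x\<close> in a corner where \<open>x\<close> is small.\<close>

lemma perturbed_inverse:
  fixes f g K :: 'a
  assumes g: "g * f * g = g" "1 - g * f \<in> \<F>" "1 - f * g \<in> \<F>" and K: "K \<in> \<F>"
  obtains h where "h * (f + K) * h = h" "1 - h * (f + K) \<in> \<F>" "1 - (f + K) * h \<in> \<F>"
proof -
  define x where "x = 1 - g * (f + K)"
  have "x = (1 - g * f) - g * K" by (simp add: x_def algebra_simps)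
  hence xF: "x \<in> \<F>" using F_diff[OF ft] F_ideal[OF ft] g K by metis
  obtain t where t: "is_proj t" "1 - t \<in> \<F>" "norm (x * t) < 1"
    using small_compl_proj[of "{x}"] xF by auto
  obtain c where c: "t * c = c" "c * t = c" "c * (1 - x) * t = t"
    using corner_inverse[OF t(1,3)] by blast
  have cF: "1 - c \<in> \<F>" by (rule F_corner_inverse[OF t(2) xF c(2) c(3)])
  have "1 - (f + K) * g = (1 - f * g) - K * g" by (simp add: algebra_simps)
  hence fF: "1 - (f + K) * g \<in> \<F>" using F_diff[OF ft] F_ideal[OF ft] g K by metis
  show ?thesis
  proof (rule that[of "c * g"])
    have "c * g * (f + K) * (c * g) = (c * (1 - x) * t) * c * g"
      unfolding x_def using c(1) by (simp add: mult.assoc mult_extend[of t c c])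
    thus "c * g * (f + K) * (c * g) = c * g" using c(1) c(3) by simp
    have "1 - c * (1 - x) \<in> \<F>" by (rule F_compl_mult[OF cF]) (simp add: xF)
    thus "1 - c * g * (f + K) \<in> \<F>" by (simp add: x_def mult.assoc)
    have "1 - (f + K) * (c * g) = (1 - (f + K) * g) + (f + K) * (1 - c) * g"
      by (simp add: algebra_simps)
    thus "1 - (f + K) * (c * g) \<in> \<F>" using fF cF F_ideal[OF ft] by metis
  qed
qed

end

section \<open>Decompositions and generalized inverses\<close>

text \<open>Splitting the unit as \<open>1 = m + n\<close> makes left multiplication by
  \<open>m\<close> the projection onto \<open>M\<close> along \<open>N\<close>.\<close>

lemma direct_decomp_idem:
  assumes "direct_decomp M N"
  obtains e where "e * e = e" "M = {x. e * x = x}" "N = {x. e * x = 0}"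
proof -
  have M: "x + y \<in> M" "x * a \<in> M" if "x \<in> M" "y \<in> M" for x y a
    using assms that unfolding direct_decomp_def closed_submodule_def by blast+
  have N: "x + y \<in> N" "x * a \<in> N" if "x \<in> N" "y \<in> N" for x y a
    using assms that unfolding direct_decomp_def closed_submodule_def by blast+
  have int: "x = 0" if "x \<in> M" "x \<in> N" for x using assms that unfolding direct_decomp_def by blast
  have "1 \<in> {x + y | x y. x \<in> M \<and> y \<in> N}" using assms unfolding direct_decomp_def by blast
  then obtain m n where mn: "1 = m + n" "m \<in> M" "n \<in> N" by blast
  have split: "x = m * x + n * x" for x using mn(1) by (metis distrib_right mult_1)
  have Mm: "m * x = x" if "x \<in> M" for x
  proof -
    \<comment> \<open>Submodules supply negatives through the right action of
      \<open>-1\<close>.\<close>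
    have "n * x = x + (m * x) * (-1)" using split[of x] by (simp add: algebra_simps)
    hence "n * x \<in> M" using M mn that by metis
    hence "n * x = 0" using int N mn by blast
    thus ?thesis using split[of x] by simp
  qed
  have Nm: "m * x = 0" if "x \<in> N" for x
  proof -
    have "m * x = x + (n * x) * (-1)" using split[of x] by (simp add: algebra_simps)
    hence "m * x \<in> N" using N mn that by metis
    thus ?thesis using int M mn by blast
  qed
  have "x \<in> M" if "m * x = x" for x using M(2)[OF mn(2) mn(2), of x] that by simp
  moreover have "x \<in> N" if "m * x = 0" for x
    using N(2)[OF mn(3) mn(3), of x] split[of x] that by simp
  ultimately show ?thesis using that[of m] Mm Nm mn by blast
qed

text \<open>Orthogonality with \<open>n = p\<close> and \<open>x = 1\<close> gives
  \<open>p\<^sup>\<star> * (1 - p) = 0\<close>, hence a projection. The defect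
  \<open>(1 - e) - p * (1 - e)\<close> lies in the kernel of \<open>e\<close> and is orthogonal to
  itself.\<close>

lemma orth_proj_range_proj:
  assumes e: "e * e = e" and P: "is_orth_proj_onto {x. e * x = 0} (left_mult p)"
  shows "range_proj p (1 - e)"
proof -
  have ep: "e * (p * x) = 0" and o: "e * n = 0 \<Longrightarrow> n\<^sup>\<star> * (x - p * x) = 0" for n x
    using P by (auto simp: is_orth_proj_onto_def left_mult_def hinner_def)
  have ep1: "e * p = 0" using ep[of 1] by simp
  have "p\<^sup>\<star> * (1 - p) = 0" using o[OF ep1, of 1] by simp
  hence ps: "p\<^sup>\<star> = p\<^sup>\<star> * p" by (simp add: algebra_simps)
  hence "p\<^sup>\<star> = p" by (metis star_mult star_star)
  hence "is_proj p" using ps by (simp add: is_proj_def)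
  moreover have "p * (1 - e) = 1 - e"
  proof -
    let ?d = "(1 - e) - p * (1 - e)"
    have "e * ?d = 0" by (simp add: algebra_simps e ep ep1)
    hence "?d\<^sup>\<star> * ?d = 0" by (rule o)
    thus ?thesis by (simp add: star_mult_zero_iff)
  qed
  ultimately show ?thesis by (simp add: range_proj_def algebra_simps ep1)
qed

lemma range_proj_orth_proj:
  assumes "range_proj p (1 - e)"
  shows "is_orth_proj_onto {x. e * x = 0} (left_mult p)"
proof -
  have p: "p * p = p" "p\<^sup>\<star> = p" "e * p = 0" "p * (1 - e) = 1 - e"
    using assms by (auto simp: range_proj_def is_proj_def algebra_simps)
  have "n\<^sup>\<star> * (x - p * x) = 0" if "e * n = 0" for n x
  proof -
    have "n = p * n" using arg_cong[OF p(4), of "\<lambda>y. y * n"] that by (simp add: algebra_simps)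
    hence "n\<^sup>\<star> = n\<^sup>\<star> * p" using p(2) by (metis star_mult)
    hence "n\<^sup>\<star> * (x - p * x) = n\<^sup>\<star> * (p * (x - p * x))" by (metis mult.assoc)
    also have "p * (x - p * x) = 0" by (simp add: right_diff_distrib p flip: mult.assoc)
    finally show ?thesis by simp
  qed
  moreover have "left_mult p \<in> module_ops"
    using bij_betw_left_mult unfolding bij_betw_def by blast
  moreover have "e * (p * x) = 0" for x using p(3) by (simp flip: mult.assoc)
  ultimately show ?thesis by (simp add: is_orth_proj_onto_def left_mult_def hinner_def)
qed

lemma idem_direct_decomp:
  fixes e :: "'a::cstar_algebra"
  assumes e: "e * e = e"
  shows "direct_decomp {x. e * x = x} {x. e * x = 0}"
  unfolding direct_decomp_def closed_submodule_def
proof (intro conjI)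
  show "closed {x. e * x = x}" "closed {x. e * x = 0}"
    by (intro closed_Collect_eq continuous_intros)+
  have "x = e * x + (1 - e) * x" "e * (e * x) = e * x" "e * ((1 - e) * x) = 0" for x
    using e by (simp_all add: algebra_simps flip: mult.assoc)
  thus "{x + y |x y. x \<in> {x. e * x = x} \<and> y \<in> {x. e * x = 0}} = UNIV" by blast
qed (auto simp: distrib_left simp flip: mult.assoc)

text \<open>The element \<open>d\<close> of \<open>M2\<close> has a preimage \<open>g\<close> in
  \<open>M1\<close>. Left multiplication by \<open>g\<close> inverts \<open>f\<close> from
  \<open>M1\<close> to \<open>M2\<close> and kills \<open>N2\<close>.\<close>

lemma mkphi_decomp_inverse:
  assumes ft: "finite_type_ideal \<F>" and D: "mkphi_decomp \<F> (left_mult f) M1 N1 M2 N2 p q"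
  obtains g where "g * f * g = g" "1 - g * f \<in> \<F>" "1 - f * g \<in> \<F>"
    "range_proj p (1 - g * f)" "range_proj q (1 - f * g)" "p \<in> \<F>" "q \<in> \<F>"
proof -
  obtain e where e: "e * e = e" "M1 = {x. e * x = x}" "N1 = {x. e * x = 0}"
    using D direct_decomp_idem unfolding mkphi_decomp_def by metis
  obtain d where d: "d * d = d" "M2 = {x. d * x = x}" "N2 = {x. d * x = 0}"
    using D direct_decomp_idem unfolding mkphi_decomp_def by metis
  have R: "range_proj p (1 - e)" "range_proj q (1 - d)" and pq: "p \<in> \<F>" "q \<in> \<F>"
    using D orth_proj_range_proj e d unfolding mkphi_decomp_def by blast+
  have inj: "x = y" if "e * x = x" "e * y = y" "f * x = f * y" for x y
    using D that by (auto simp: mkphi_decomp_def bij_betw_def inj_on_def e left_mult_def)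
  have M: "d * (f * x) = f * x" if "e * x = x" for x
    using D that by (auto simp: mkphi_decomp_def bij_betw_def e d left_mult_def)
  have N: "d * (f * x) = 0" if "e * x = 0" for x
    using D that by (auto simp: mkphi_decomp_def e d left_mult_def image_subset_iff)
  have "d \<in> left_mult f ` M1" using D d unfolding mkphi_decomp_def bij_betw_def by blast
  then obtain g where g: "f * g = d" "e * g = g" by (auto simp: left_mult_def e)
  have eg: "e * (g * x) = g * x" for x using g by (metis mult.assoc)
  have fg: "f * (g * x) = d * x" for x using g by (metis mult.assoc)
  \<comment> \<open>Identities between elements of \<open>M1\<close> are checked after applying
    \<open>f\<close>, which is injective there.\<close>
  have gd: "g * d = g" by (rule inj) (simp_all add: eg fg g d)
  have "g * (f * e) = e" by (rule inj) (simp_all add: eg fg e M)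
  moreover have "d * (f * (1 - e)) = 0" by (rule N) (simp add: right_diff_distrib e)
  hence fz: "f * (g * (f * (1 - e))) = 0" by (simp only: fg)
  have "g * (f * (1 - e)) = 0" by (rule inj) (simp_all only: eg fz mult_zero_right)
  ultimately have gf: "g * f = e" by (simp add: algebra_simps)
  have "1 - e = p * (1 - e)" "1 - d = q * (1 - d)" using R by (auto simp: range_proj_def)
  hence F: "1 - e \<in> \<F>" "1 - d \<in> \<F>" using F_ideal(2)[OF ft] pq by metis+
  show ?thesis using that[of g] gf g gd F R pq by (simp add: mult.assoc)
qed

text \<open>\<open>g\<close> inverts \<open>f\<close> between the fixed spaces of
  \<open>g * f\<close> and \<open>f * g\<close>. On the kernel of \<open>g * f\<close>,
  \<open>f\<close> may be nonzero but maps into the kernel of \<open>f * g\<close>; this is the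
  corner \<open>F_4\<close>.\<close>

lemma inverse_mkphi_decomp:
  assumes g: "g * f * g = g" and R: "range_proj p (1 - g * f)" "range_proj q (1 - f * g)"
    and F: "p \<in> \<F>" "q \<in> \<F>"
  shows "mkphi_decomp \<F> (left_mult f) {x. g * f * x = x} {x. g * f * x = 0}
    {x. f * g * x = x} {x. f * g * x = 0} p q"
proof -
  have i: "g * f * (g * f) = g * f" "f * g * (f * g) = f * g" using g by (metis mult.assoc)+
  have "bij_betw (left_mult f) {x. g * f * x = x} {x. f * g * x = x}"
    by (rule bij_betw_byWitness[where f' = "left_mult g"]) (auto simp: left_mult_def mult.assoc)
  moreover have "left_mult f ` {x. g * f * x = 0} \<subseteq> {x. f * g * x = 0}"
    by (auto simp: left_mult_def mult.assoc)
  ultimately show ?thesis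
    unfolding mkphi_decomp_def using R F i by (simp add: idem_direct_decomp range_proj_orth_proj)
qed

lemma mkphi_index_eq:
  assumes ft: "finite_type_ideal \<F>"
    and g: "g * f * g = g" "1 - g * f \<in> \<F>" "1 - f * g \<in> \<F>"
    and R: "range_proj p (1 - g * f)" "range_proj q (1 - f * g)"
  shows "mkphi_index \<F> (left_mult f)
    = groth_rel (S_carrier \<F>) (S_add \<F>) `` {(mvn_rel \<F> `` {p}, mvn_rel \<F> `` {q})}"
  unfolding mkphi_index_def
proof (rule the_equality)
  have P: "p \<in> Projs \<F>" "q \<in> Projs \<F>" using range_proj_in[OF ft] R g by blast+
  have "mkphi_decomp \<F> (left_mult f) {x. g * f * x = x} {x. g * f * x = 0}
    {x. f * g * x = x} {x. f * g * x = 0} p q"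
    using inverse_mkphi_decomp[OF g(1) R] P by (simp add: Projs_def)
  moreover note K_diff[OF ft P, symmetric]
  ultimately show "\<exists>M1 N1 M2 N2 p' q'. mkphi_decomp \<F> (left_mult f) M1 N1 M2 N2 p' q' \<and>
      groth_rel (S_carrier \<F>) (S_add \<F>) `` {(mvn_rel \<F> `` {p}, mvn_rel \<F> `` {q})}
      = K_class \<F> p' \<otimes>\<^bsub>K_group \<F>\<^esub> inv\<^bsub>K_group \<F>\<^esub> (K_class \<F> q')"
    by blast
next
  fix k
  assume "\<exists>M1 N1 M2 N2 p q. mkphi_decomp \<F> (left_mult f) M1 N1 M2 N2 p q \<and>
      k = K_class \<F> p \<otimes>\<^bsub>K_group \<F>\<^esub> inv\<^bsub>K_group \<F>\<^esub> (K_class \<F> q)"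
  then obtain M1 N1 M2 N2 p' q' where D: "mkphi_decomp \<F> (left_mult f) M1 N1 M2 N2 p' q'"
    and k: "k = K_class \<F> p' \<otimes>\<^bsub>K_group \<F>\<^esub> inv\<^bsub>K_group \<F>\<^esub> (K_class \<F> q')" by blast
  obtain h where h: "h * f * h = h" "1 - h * f \<in> \<F>" "1 - f * h \<in> \<F>"
    "range_proj p' (1 - h * f)" "range_proj q' (1 - f * h)"
    by (rule mkphi_decomp_inverse[OF ft D])
  have "p' \<in> Projs \<F>" "q' \<in> Projs \<F>" using range_proj_in[OF ft] h by blast+
  hence "k = groth_rel (S_carrier \<F>) (S_add \<F>) `` {(mvn_rel \<F> `` {p'}, mvn_rel \<F> `` {q'})}"
    using k K_diff[OF ft] by simp
  \<comment> \<open>Both generalized inverses belong to the same \<open>f\<close>, so the difference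
    required in the ideal is \<open>0\<close>.\<close>
  also have "\<dots> = groth_rel (S_carrier \<F>) (S_add \<F>) `` {(mvn_rel \<F> `` {p}, mvn_rel \<F> `` {q})}"
    by (rule index_unique[OF ft h g R]) (simp add: F_ideal(4)[OF ft])
  finally show "k = \<dots>" .
qed

theorem lemma2p11:
  fixes \<F> :: "'a::cstar_algebra set" and F :: "'a \<Rightarrow> 'a" and K :: 'a
  assumes "finite_type_ideal \<F>"
    and "F \<in> MKPhi \<F>"
    and "K \<in> \<F>"
  shows "(\<lambda>x. F x + left_mult K x) \<in> MKPhi \<F> \<and>
         mkphi_index \<F> (\<lambda>x. F x + left_mult K x) = mkphi_index \<F> F"
proof -
  obtain f where f: "F = left_mult f"
    using assms(2) bij_betw_left_mult unfolding MKPhi_def bij_betw_def by blast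
  have fK: "(\<lambda>x. F x + left_mult K x) = left_mult (f + K)"
    by (simp add: f left_mult_def distrib_right fun_eq_iff)
  obtain M1 N1 M2 N2 p q where D: "mkphi_decomp \<F> (left_mult f) M1 N1 M2 N2 p q"
    using assms(2) unfolding MKPhi_def f by blast
  obtain g where g: "g * f * g = g" "1 - g * f \<in> \<F>" "1 - f * g \<in> \<F>"
    "range_proj p (1 - g * f)" "range_proj q (1 - f * g)"
    by (rule mkphi_decomp_inverse[OF assms(1) D])
  obtain h where h: "h * (f + K) * h = h" "1 - h * (f + K) \<in> \<F>" "1 - (f + K) * h \<in> \<F>"
    using perturbed_inverse[OF assms(1) g(1-3) assms(3)] .
  have "h * (f + K) * (h * (f + K)) = h * (f + K)" "(f + K) * h * ((f + K) * h) = (f + K) * h"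
    using h(1) by (metis mult.assoc)+
  hence "(1 - h * (f + K)) * (1 - h * (f + K)) = 1 - h * (f + K)"
    "(1 - (f + K) * h) * (1 - (f + K) * h) = 1 - (f + K) * h"
    by (simp_all only: left_diff_distrib right_diff_distrib mult_1_left mult_1_right diff_self diff_zero)
  then obtain r s where R: "range_proj r (1 - h * (f + K))" "range_proj s (1 - (f + K) * h)"
    using range_proj_exists by metis
  have "mkphi_decomp \<F> (left_mult (f + K)) {x. h * (f + K) * x = x} {x. h * (f + K) * x = 0}
    {x. (f + K) * h * x = x} {x. (f + K) * h * x = 0} r s"
    using inverse_mkphi_decomp[OF h(1) R] range_proj_in[OF assms(1)] R h by (simp add: Projs_def)
  moreover have "left_mult (f + K) \<in> module_ops"
    using bij_betw_left_mult unfolding bij_betw_def by blast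
  ultimately have "left_mult (f + K) \<in> MKPhi \<F>" unfolding MKPhi_def by blast
  \<comment> \<open>Independence of the index already compares operators that differ by an element
    of the ideal, here \<open>K\<close>.\<close>
  moreover have "mkphi_index \<F> (left_mult (f + K)) = mkphi_index \<F> (left_mult f)"
    unfolding mkphi_index_eq[OF assms(1) h R] mkphi_index_eq[OF assms(1) g]
    by (rule index_unique[OF assms(1) g h R, symmetric]) (simp add: assms(3))
  ultimately show ?thesis unfolding fK by (simp only: f)
qed

end
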